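(* Let $f\colon M^n= M_0^{n-1}\times I\to \mathbb{R}^{n+1}$ be a hypersurface of Enneper type with respect to the product net $\mathcal{E}= (E_0, E_1)$ of $M^n$. Assume that its Gauss map $N\colon M^n\to \mathbb{S}^n$ is a local diffeomorphism whose induced metric is $d\sigma^2=g_s+\rho^2ds^2$, with $\rho\in C^\infty(M)$ and $g_s$ a smooth family of metrics on $M_0$ indexed on $I$, and that $$f=\gamma+\alpha N +\beta \rho^{-1}N_*\partial_s$$ for a smooth regular curve $\gamma\colon I\to \mathbb{R}^{n+1}$ and $\alpha, \beta\in C^{\infty}(I)$ satisfying $\langle\gamma', N\rangle+\alpha'=\beta\rho$. Suppose also that there does not exist any leaf $s=s_0$ of $E_0$ whose image by $f$ is (an open piece of) a round $(n-1)$-dimensional sphere. Then any other hypersurface $\bar f\colon M^n\to \mathbb{R}^{n+1}$ of Enneper type with respect to $\mathcal{E}$ having $N$ as a Gauss map is parametrized by $$\bar f=\bar\gamma+\bar\alpha N +\bar\beta \rho^{-1}N_*\partial_s$$ in terms of a smooth curve $\bar\gamma\colon I\to \mathbb{R}^{n+1}$ and $\bar\alpha, \bar\beta\in C^{\infty}(I)$ which are related to $\gamma$, $\alpha$ and $\beta$ by $$ \bar\beta=\lambda \beta,\quad\bar\alpha'=\lambda \alpha'\quad\text{and}\quad\bar\gamma'=\lambda\gamma' $$ for some $\lambda\in C^{\infty}(I)$.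
   Context: $I\subset\mathbb{R}$ is an open interval with standard coordinate $s$ and unit field $\partial_s$; prime denotes derivative with respect to $s$; $\rho>0$; a regular curve has nowhere vanishing derivative. The product net $(E_0,E_1)$ of $M_0\times I$ consists of the distributions formed by the tangent spaces to $M_0$ and to $I$; the leaves of $E_0$ are the sets $M_0\times\{s\}$. A hypersurface $f\colon M_0^{n-1}\times I\to\mathbb{R}^{n+1}$ is of Enneper type with respect to $\mathcal{E}$ if: (i) $\mathcal{E}$ is orthogonal with respect to the metric induced by $f$; (ii) the second fundamental form of $f$ is adapted to $\mathcal{E}$, i.e. $\alpha^f(X_0,X_1)=0$ for $X_0\in\Gamma(E_0)$, $X_1\in\Gamma(E_1)$; (iii') the image by $f$ of each leaf of $E_0$ is contained in a hypersphere of $\mathbb{R}^{n+1}$ (which does not necessarily intersect $f(M)$ orthogonally). Vectors tangent to $\mathbb{S}^n$ are regarded as vectors of $\mathbb{R}^{n+1}$. *)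

theory Defs
  imports "HOL-Analysis.Analysis"
begin

section \<open>Smooth maps between Euclidean spaces\<close>

primrec Ck_on :: "nat \<Rightarrow> 'a::real_normed_vector set \<Rightarrow> ('a \<Rightarrow> 'b::real_normed_vector) \<Rightarrow> bool" where
  "Ck_on 0 S F \<longleftrightarrow> continuous_on S F"
| "Ck_on (Suc k) S F \<longleftrightarrow>
     (\<forall>x\<in>S. F differentiable (at x)) \<and> (\<forall>v. Ck_on k S (\<lambda>x. frechet_derivative F (at x) v))"

text \<open>Only meant for open \<open>S\<close>: the derivatives are taken in the whole space.\<close>

definition smooth_on :: "'a::real_normed_vector set \<Rightarrow> ('a \<Rightarrow> 'b::real_normed_vector) \<Rightarrow> bool" where
  "smooth_on S F \<longleftrightarrow> (\<forall>k. Ck_on k S F)"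

text \<open>Smoothness on an arbitrary subset: local extendability to smooth maps on open sets.\<close>

definition smooth_on_subset :: "'a::real_normed_vector set \<Rightarrow> ('a \<Rightarrow> 'b::real_normed_vector) \<Rightarrow> bool" where
  "smooth_on_subset S F \<longleftrightarrow>
     (\<forall>y\<in>S. \<exists>V G. open V \<and> y \<in> V \<and> smooth_on V G \<and> (\<forall>z\<in>S \<inter> V. G z = F z))"

section \<open>Smooth manifolds\<close>

text \<open>A chart is a pair of its domain and its coordinate map. The coordinate map is a total
  function whose values outside the domain are irrelevant. The dimension of the manifold is
  the dimension of the model space \<open>'e\<close>.\<close>

type_synonym ('m, 'e) chart = "'m set \<times> ('m \<Rightarrow> 'e)"

definition chart_inv :: "('m, 'e) chart \<Rightarrow> 'e \<Rightarrow> 'm" where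
  "chart_inv c = inv_into (fst c) (snd c)"

definition chart_image :: "('m, 'e) chart \<Rightarrow> 'e set" where
  "chart_image c = snd c ` fst c"

definition is_chart :: "'m topology \<Rightarrow> ('m, 'e::euclidean_space) chart \<Rightarrow> bool" where
  "is_chart X c \<longleftrightarrow> openin X (fst c) \<and> open (chart_image c) \<and>
     homeomorphic_map (subtopology X (fst c)) (top_of_set (chart_image c)) (snd c)"

definition transition :: "('m, 'e) chart \<Rightarrow> ('m, 'e) chart \<Rightarrow> 'e \<Rightarrow> 'e" where
  "transition c d = snd d \<circ> chart_inv c"

definition smooth_manifold :: "'m topology \<Rightarrow> ('m, 'e::euclidean_space) chart set \<Rightarrow> bool" where
  "smooth_manifold X A \<longleftrightarrow>
     Hausdorff_space X \<and> second_countable X \<and>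
     (\<forall>c\<in>A. is_chart X c) \<and> (\<Union>c\<in>A. fst c) = topspace X \<and>
     (\<forall>c\<in>A. \<forall>d\<in>A. smooth_on (snd c ` (fst c \<inter> fst d)) (transition c d))"

text \<open>A tangent vector at \<open>x\<close> is a family of coordinate vectors, one for each chart around \<open>x\<close>,
  which transform into each other by the derivatives of the transition maps. Charts that do not
  contain \<open>x\<close> are assigned \<open>0\<close>, so that tangent vectors are equal iff their coordinates are.
  The linear structure is pointwise.\<close>

type_synonym ('m, 'e) tvec = "('m, 'e) chart \<Rightarrow> 'e"

definition tangent_space :: "('m, 'e::euclidean_space) chart set \<Rightarrow> 'm \<Rightarrow> ('m, 'e) tvec set" where
  "tangent_space A x =
     {X. (\<forall>c\<in>A. \<forall>d\<in>A. x \<in> fst c \<and> x \<in> fst d \<longrightarrow>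
            X d = frechet_derivative (transition c d) (at (snd c x)) (X c)) \<and>
         (\<forall>c. \<not> (c \<in> A \<and> x \<in> fst c) \<longrightarrow> X c = 0)}"

definition coord_tvec :: "('m, 'e::euclidean_space) chart set \<Rightarrow> ('m, 'e) chart \<Rightarrow> 'm \<Rightarrow> 'e \<Rightarrow> ('m, 'e) tvec" where
  "coord_tvec A c x v =
     (\<lambda>d. if d \<in> A \<and> x \<in> fst d then frechet_derivative (transition c d) (at (snd c x)) v else 0)"

definition chart_at :: "('m, 'e) chart set \<Rightarrow> 'm \<Rightarrow> ('m, 'e) chart" where
  "chart_at A x = (SOME c. c \<in> A \<and> x \<in> fst c)"

text \<open>A smooth family, indexed by \<open>I\<close>, of Riemannian metrics on the manifold.\<close>

definition smooth_metric_family ::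
    "('m, 'e::euclidean_space) chart set \<Rightarrow> real set \<Rightarrow>
     (real \<Rightarrow> 'm \<Rightarrow> ('m, 'e) tvec \<Rightarrow> ('m, 'e) tvec \<Rightarrow> real) \<Rightarrow> bool" where
  "smooth_metric_family A I g \<longleftrightarrow>
     (\<forall>s\<in>I. \<forall>x\<in>(\<Union>c\<in>A. fst c).
        (\<forall>X\<in>tangent_space A x. \<forall>Y\<in>tangent_space A x. g s x X Y = g s x Y X) \<and>
        (\<forall>X\<in>tangent_space A x. \<forall>Y\<in>tangent_space A x. \<forall>Z\<in>tangent_space A x. \<forall>a b.
           g s x (\<lambda>c. a *\<^sub>R X c + b *\<^sub>R Y c) Z = a * g s x X Z + b * g s x Y Z) \<and>
        (\<forall>X\<in>tangent_space A x. X \<noteq> (\<lambda>_. 0) \<longrightarrow> 0 < g s x X X)) \<and>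
     (\<forall>c\<in>A. \<forall>v w.
        smooth_on (chart_image c \<times> I)
          (\<lambda>(u, s). g s (chart_inv c u) (coord_tvec A c (chart_inv c u) v)
                                       (coord_tvec A c (chart_inv c u) w)))"

section \<open>The product of a manifold and an open interval\<close>

text \<open>In this section \<open>A\<close> is an atlas of \<open>M\<^sub>0\<close>, and \<open>M = M\<^sub>0 \<times> I\<close> carries the product topology and
  the charts \<open>\<phi> \<times> id\<close>. The tangent space of \<open>M\<close> at \<open>(x, s)\<close> is identified with
  \<open>T\<^sub>x M\<^sub>0 \<times> \<real>\<close>, the second component being the coefficient of \<open>\<partial>\<^sub>s\<close>.\<close>

definition local_rep :: "('m, 'e) chart \<Rightarrow> ('m \<times> real \<Rightarrow> 'v) \<Rightarrow> 'e \<times> real \<Rightarrow> 'v" where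
  "local_rep c F = (\<lambda>(u, s). F (chart_inv c u, s))"

definition smooth_fun :: "('m, 'e::euclidean_space) chart set \<Rightarrow> real set \<Rightarrow>
    ('m \<times> real \<Rightarrow> 'v::real_normed_vector) \<Rightarrow> bool" where
  "smooth_fun A I F \<longleftrightarrow> (\<forall>c\<in>A. smooth_on (chart_image c \<times> I) (local_rep c F))"

definition prod_manifold :: "('m, 'e) chart set \<Rightarrow> real set \<Rightarrow> ('m \<times> real) set" where
  "prod_manifold A I = (\<Union>c\<in>A. fst c) \<times> I"

definition prod_tangent :: "('m, 'e::euclidean_space) chart set \<Rightarrow> 'm \<times> real \<Rightarrow> (('m, 'e) tvec \<times> real) set" where
  "prod_tangent A p = tangent_space A (fst p) \<times> UNIV"

definition E0 :: "('m, 'e::euclidean_space) chart set \<Rightarrow> 'm \<times> real \<Rightarrow> (('m, 'e) tvec \<times> real) set" where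
  "E0 A p = tangent_space A (fst p) \<times> {0}"

definition E1 :: "'m \<times> real \<Rightarrow> (('m, 'e::euclidean_space) tvec \<times> real) set" where
  "E1 p = {\<lambda>_. 0} \<times> UNIV"

definition leaf :: "('m, 'e) chart set \<Rightarrow> real \<Rightarrow> ('m \<times> real) set" where
  "leaf A s = (\<Union>c\<in>A. fst c) \<times> {s}"

definition d_s :: "('m, 'e::euclidean_space) tvec \<times> real" where
  "d_s = (\<lambda>_. 0, 1)"

text \<open>The differential \<open>F\<^sub>*\<close> at \<open>p\<close>; by the chain rule it does not depend on the chart.\<close>

definition push :: "('m, 'e::euclidean_space) chart set \<Rightarrow> ('m \<times> real \<Rightarrow> 'v::real_normed_vector) \<Rightarrow>
    'm \<times> real \<Rightarrow> ('m, 'e) tvec \<times> real \<Rightarrow> 'v" where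
  "push A F p V =
     (let c = chart_at A (fst p)
      in frechet_derivative (local_rep c F) (at (snd c (fst p), snd p)) (fst V c, snd V))"

definition induced_metric :: "('m, 'e::euclidean_space) chart set \<Rightarrow> ('m \<times> real \<Rightarrow> 'v::real_inner) \<Rightarrow>
    'm \<times> real \<Rightarrow> ('m, 'e) tvec \<times> real \<Rightarrow> ('m, 'e) tvec \<times> real \<Rightarrow> real" where
  "induced_metric A F p V W = push A F p V \<bullet> push A F p W"

definition immersion :: "('m, 'e::euclidean_space) chart set \<Rightarrow> real set \<Rightarrow>
    ('m \<times> real \<Rightarrow> 'v::euclidean_space) \<Rightarrow> bool" where
  "immersion A I f \<longleftrightarrow> smooth_fun A I f \<and>
     (\<forall>p\<in>prod_manifold A I. inj_on (push A f p) (prod_tangent A p))"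

definition normal_part :: "'v::euclidean_space set \<Rightarrow> 'v \<Rightarrow> 'v" where
  "normal_part T v = (THE w. v - w \<in> T \<and> (\<forall>u\<in>T. w \<bullet> u = 0))"

text \<open>\<open>\<alpha>\<^sup>f(V, W)\<close> is the normal component of \<open>D\<^sub>V (f\<^sub>* W)\<close>, where \<open>D\<close> is the flat connection
  of the ambient space and \<open>W\<close> is extended to a vector field with constant coordinates in a
  product chart. As \<open>\<alpha>\<^sup>f\<close> is tensorial, neither the extension nor the chart matters.\<close>

definition second_ff :: "('m, 'e::euclidean_space) chart set \<Rightarrow> ('m \<times> real \<Rightarrow> 'v::euclidean_space) \<Rightarrow>
    'm \<times> real \<Rightarrow> ('m, 'e) tvec \<times> real \<Rightarrow> ('m, 'e) tvec \<times> real \<Rightarrow> 'v" where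
  "second_ff A f p V W =
     (let c = chart_at A (fst p)
      in normal_part (push A f p ` prod_tangent A p)
           (frechet_derivative
              (\<lambda>q. frechet_derivative (local_rep c f) (at q) (fst W c, snd W))
              (at (snd c (fst p), snd p)) (fst V c, snd V)))"

definition enneper_type :: "('m, 'e::euclidean_space) chart set \<Rightarrow> real set \<Rightarrow>
    ('m \<times> real \<Rightarrow> 'v::euclidean_space) \<Rightarrow> bool" where
  "enneper_type A I f \<longleftrightarrow>
     immersion A I f \<and>
     (\<forall>p\<in>prod_manifold A I. \<forall>V\<in>E0 A p. \<forall>W\<in>E1 p. induced_metric A f p V W = 0) \<and>
     (\<forall>p\<in>prod_manifold A I. \<forall>V\<in>E0 A p. \<forall>W\<in>E1 p. second_ff A f p V W = 0) \<and>
     (\<forall>s\<in>I. \<exists>c r. 0 < r \<and> f ` leaf A s \<subseteq> sphere c r)"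

definition gauss_map :: "('m, 'e::euclidean_space) chart set \<Rightarrow> real set \<Rightarrow>
    ('m \<times> real \<Rightarrow> 'v::euclidean_space) \<Rightarrow> ('m \<times> real \<Rightarrow> 'v) \<Rightarrow> bool" where
  "gauss_map A I f N \<longleftrightarrow> smooth_fun A I N \<and>
     (\<forall>p\<in>prod_manifold A I. N p \<in> sphere 0 1 \<and> (\<forall>V\<in>prod_tangent A p. N p \<bullet> push A f p V = 0))"

text \<open>Local diffeomorphism into the unit sphere. The neighbourhood \<open>W\<close> may be taken inside the
  domain of a product chart, and the inverse of the restriction to \<open>W\<close> is then read in that chart.\<close>

definition local_diffeo_sphere :: "'m topology \<Rightarrow> ('m, 'e::euclidean_space) chart set \<Rightarrow> real set \<Rightarrow>
    ('m \<times> real \<Rightarrow> 'v::euclidean_space) \<Rightarrow> bool" where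
  "local_diffeo_sphere X A I N \<longleftrightarrow> smooth_fun A I N \<and>
     (\<forall>p\<in>prod_manifold A I. \<exists>c\<in>A. \<exists>W.
        p \<in> W \<and> W \<subseteq> fst c \<times> I \<and> openin (prod_topology X (top_of_set I)) W \<and>
        inj_on N W \<and> openin (top_of_set (sphere 0 1)) (N ` W) \<and>
        smooth_on_subset (N ` W) (\<lambda>y. map_prod (snd c) id (inv_into W N y)))"

text \<open>In an ambient space of dimension \<open>n + 1\<close> the following are the round spheres of
  dimension \<open>n - 1\<close>, i.e. the spheres of the affine hyperplanes.\<close>

definition round_sphere_codim2 :: "'v::euclidean_space set \<Rightarrow> bool" where
  "round_sphere_codim2 S \<longleftrightarrow> (\<exists>c r v. 0 < r \<and> v \<noteq> 0 \<and> S = {y \<in> sphere c r. (y - c) \<bullet> v = 0})"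

end

theory Submission
  imports Defs
begin

text \<open>Write \<open>T = \<rho>\<^sup>-\<^sup>1 N\<^sub>*\<partial>\<^sub>s\<close>. Adaptedness of the second fundamental form and orthogonality of the net make
  the leaves of a hypersurface \<open>h\<close> of Enneper type tangent to the complement of \<open>N\<close> and \<open>T\<close>, so a
  leaf in a sphere with centre \<open>c\<close> satisfies \<open>h = c + a N + b T\<close> with \<open>a\<close> and \<open>b\<close> constant on it.
  If \<open>N\<close> maps a leaf into a hyperplane, then \<open>T\<close> is an affine function of \<open>N\<close> there, and the
  leaf of \<open>f\<close> is round. Hence \<open>N\<close> maps no leaf into a hyperplane. It follows that \<open>c\<close>, \<open>a\<close>
  and \<open>b\<close> are unique and smooth in \<open>s\<close>, and that \<open>\<beta>\<close> has no zeros by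
  \<open>\<gamma>' \<bullet> N + \<alpha>' = \<beta> \<rho>\<close> and regularity of \<open>\<gamma>\<close>. Since \<open>c' \<bullet> N + a' = b \<rho>\<close> holds for the second
  hypersurface, \<open>\<lambda> = b / \<beta>\<close> satisfies \<open>(c' - \<lambda> \<gamma>') \<bullet> N + (a' - \<lambda> \<alpha>') = 0\<close>, so both differences
  vanish.\<close>

section \<open>Calculus of smooth maps\<close>

lemma Ck_on_cong:
  assumes "open S" "\<And>x. x \<in> S \<Longrightarrow> F x = G x"
  shows "Ck_on k S F \<longleftrightarrow> Ck_on k S G"
  using assms(2)
proof (induction k arbitrary: F G)
  case 0
  then show ?case by (simp cong: continuous_on_cong)
next
  case (Suc k)
  have der: "(F has_derivative D) (at x) \<longleftrightarrow> (G has_derivative D) (at x)" if "x \<in> S" for x D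
    using has_derivative_transform_within_open[OF _ assms(1) that] Suc.prems by metis
  then have "F differentiable (at x) \<longleftrightarrow> G differentiable (at x)"
    and "frechet_derivative F (at x) = frechet_derivative G (at x)" if "x \<in> S" for x
    using that unfolding differentiable_def frechet_derivative_def by auto
  then show ?case
    using Suc.IH[of "\<lambda>x. frechet_derivative F (at x) _" "\<lambda>x. frechet_derivative G (at x) _"]
    by simp
qed

lemma Ck_on_subset: "Ck_on k S F \<Longrightarrow> T \<subseteq> S \<Longrightarrow> Ck_on k T F"
  by (induction k arbitrary: F) (auto intro: continuous_on_subset)

lemma Ck_on_Suc_imp: "Ck_on (Suc k) S F \<Longrightarrow> Ck_on k S F"
proof (induction k arbitrary: F)
  case 0
  then have "F differentiable_on S"
    by (simp add: differentiable_on_def differentiable_at_withinI)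
  then show ?case
    by (simp add: differentiable_imp_continuous_on)
next
  case (Suc k)
  then show ?case by (metis Ck_on.simps(2))
qed

text \<open>Serves to glue: solutions of linear systems are first shown to be C^k only near each
  point, on a neighbourhood that depends on the point.\<close>

lemma Ck_on_local:
  assumes "\<And>x. x \<in> S \<Longrightarrow> \<exists>U. open U \<and> x \<in> U \<and> Ck_on k U F"
  shows "Ck_on k S F"
  using assms
proof (induction k arbitrary: F)
  case 0
  then show ?case
    by (metis Ck_on.simps(1) continuous_at_imp_continuous_on continuous_on_eq_continuous_at)
next
  case (Suc k)
  have "F differentiable (at x)" if "x \<in> S" for x
    using Suc.prems[OF that] by auto
  moreover have "Ck_on k S (\<lambda>x. frechet_derivative F (at x) v)" for v
    using Suc.prems by (intro Suc.IH) fastforce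
  ultimately show ?case by simp
qed

text \<open>By uniqueness of derivatives any explicit \<open>D\<close> agrees with
  \<open>frechet_derivative\<close>, so the calculus rules can supply the derivative in each
  induction on k.\<close>

lemma Ck_on_SucI:
  assumes "open S" "\<And>x. x \<in> S \<Longrightarrow> (F has_derivative D x) (at x)"
    and "\<And>v. Ck_on k S (\<lambda>x. D x v)"
  shows "Ck_on (Suc k) S F"
proof -
  have "frechet_derivative F (at x) = D x" if "x \<in> S" for x
    using frechet_derivative_at[OF assms(2)[OF that]] by simp
  then have "Ck_on k S (\<lambda>x. frechet_derivative F (at x) v)" for v
    using assms(3)[of v] by (auto intro: Ck_on_cong[OF assms(1), THEN iffD1, rotated])
  moreover have "F differentiable (at x)" if "x \<in> S" for x
    using assms(2)[OF that] by (rule differentiableI)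
  ultimately show ?thesis by simp
qed

lemma Ck_on_SucD:
  assumes "Ck_on (Suc k) S F"
  shows "x \<in> S \<Longrightarrow> (F has_derivative frechet_derivative F (at x)) (at x)"
    and "Ck_on k S (\<lambda>x. frechet_derivative F (at x) v)"
  using assms by (simp_all add: frechet_derivative_works[symmetric])

lemma Ck_on_const: "Ck_on k S (\<lambda>x. c)"
  by (induction k arbitrary: c) auto

lemma Ck_on_add:
  assumes "open S" "Ck_on k S F" "Ck_on k S G"
  shows "Ck_on k S (\<lambda>x. F x + G x)"
  using assms(2-)
proof (induction k arbitrary: F G)
  case 0
  then show ?case by (auto intro: continuous_on_add)
next
  case (Suc k)
  show ?case
    by (rule Ck_on_SucI[OF assms(1) has_derivative_add[OF Suc.prems[THEN Ck_on_SucD(1)]]])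
      (use Suc.IH Suc.prems[THEN Ck_on_SucD(2)] in blast)+
qed

text \<open>Induction with the Leibniz rule: both summands of the derivative are again products of
  C^k factors. Inner products and scalar multiples are instances.\<close>

lemma (in bounded_bilinear) Ck_on:
  assumes "open S" "Ck_on k S F" "Ck_on k S G"
  shows "Ck_on k S (\<lambda>x. prod (F x) (G x))"
  using assms(2-)
proof (induction k arbitrary: F G)
  case 0
  then show ?case by (auto intro: continuous_on)
next
  case (Suc k)
  show ?case
  proof (rule Ck_on_SucI[OF assms(1) FDERIV[OF Suc.prems[THEN Ck_on_SucD(1)]]])
    fix v
    show "Ck_on k S (\<lambda>x. prod (F x) (frechet_derivative G (at x) v)
        + prod (frechet_derivative F (at x) v) (G x))"
      by (intro Ck_on_add assms(1) Suc.IH Ck_on_SucD(2) Suc.prems Ck_on_Suc_imp)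
  qed
qed

lemma smooth_on_cong:
  assumes "open S" "\<And>x. x \<in> S \<Longrightarrow> F x = G x"
  shows "smooth_on S F \<longleftrightarrow> smooth_on S G"
  unfolding smooth_on_def using Ck_on_cong[OF assms] by simp

lemma smooth_on_const: "smooth_on S (\<lambda>x. c)"
  by (simp add: smooth_on_def Ck_on_const)

lemma smooth_on_add:
  "open S \<Longrightarrow> smooth_on S F \<Longrightarrow> smooth_on S G \<Longrightarrow> smooth_on S (\<lambda>x. F x + G x)"
  unfolding smooth_on_def using Ck_on_add by blast

lemma smooth_on_inner:
  "open S \<Longrightarrow> smooth_on S F \<Longrightarrow> smooth_on S G \<Longrightarrow> smooth_on S (\<lambda>x. F x \<bullet> G x)"
  unfolding smooth_on_def using bounded_bilinear.Ck_on[OF bounded_bilinear_inner] by blast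

lemma smooth_on_scaleR:
  "open S \<Longrightarrow> smooth_on S F \<Longrightarrow> smooth_on S G \<Longrightarrow> smooth_on S (\<lambda>x. F x *\<^sub>R G x)"
  unfolding smooth_on_def using bounded_bilinear.Ck_on[OF bounded_bilinear_scaleR] by blast

lemma smooth_on_diff:
  assumes "open S" "smooth_on S F" "smooth_on S G"
  shows "smooth_on S (\<lambda>x. F x - G x)"
  using smooth_on_add[OF assms(1,2) smooth_on_scaleR[OF assms(1) smooth_on_const[of S "-1"] assms(3)]]
  by simp

lemma smooth_on_linear:
  fixes F :: "'a::real_normed_vector \<Rightarrow> 'b::real_normed_vector"
  assumes "bounded_linear h" "open S" "smooth_on S F"
  shows "smooth_on S (\<lambda>x. h (F x))"
proof -
  have "Ck_on k S F \<Longrightarrow> Ck_on k S (\<lambda>x. h (F x))" for k and F :: "'a \<Rightarrow> 'b"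
  proof (induction k arbitrary: F)
    case 0
    then show ?case by (auto intro: bounded_linear.continuous_on[OF assms(1)])
  next
    case (Suc k)
    show ?case
      by (rule Ck_on_SucI[OF assms(2) bounded_linear.has_derivative[OF assms(1) Ck_on_SucD(1)[OF Suc.prems]]])
        (use Suc.IH Ck_on_SucD(2)[OF Suc.prems] in blast)+
  qed
  then show ?thesis using assms(3) by (simp add: smooth_on_def)
qed

lemma smooth_on_differentiable: "smooth_on S F \<Longrightarrow> x \<in> S \<Longrightarrow> F differentiable (at x)"
  unfolding smooth_on_def by (metis Ck_on.simps(2))

lemma smooth_on_continuous: "smooth_on S F \<Longrightarrow> continuous_on S F"
  unfolding smooth_on_def by (metis Ck_on.simps(1))

lemma smooth_on_derivative: "smooth_on S F \<Longrightarrow> smooth_on S (\<lambda>x. frechet_derivative F (at x) v)"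
  unfolding smooth_on_def by (metis Ck_on.simps(2))

lemma Ck_on_vector_derivative:
  assumes "open S" "Ck_on (Suc k) S F"
  shows "Ck_on k S (\<lambda>s. vector_derivative F (at s))"
proof -
  have eq: "frechet_derivative F (at s) 1 = vector_derivative F (at s)" if "s \<in> S" for s
    using frechet_derivative_eq_vector_derivative[of F s] assms(2) that by simp
  show ?thesis
    by (rule Ck_on_cong[OF assms(1), THEN iffD1, OF _ Ck_on_SucD(2)[OF assms(2), of 1]]) (rule eq)
qed

lemma smooth_on_vector_derivative:
  "open S \<Longrightarrow> smooth_on S F \<Longrightarrow> smooth_on S (\<lambda>s. vector_derivative F (at s))"
  unfolding smooth_on_def using Ck_on_vector_derivative by blast

lemma smooth_on_has_vector_derivative:
  "smooth_on S F \<Longrightarrow> s \<in> S \<Longrightarrow> (F has_vector_derivative vector_derivative F (at s)) (at s)"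
  using smooth_on_differentiable vector_derivative_works by blast

text \<open>The derivative of a slice is the slice of the derivative in direction (0, v), so
  induction on k applies.\<close>

lemma smooth_on_slice:
  fixes F :: "'a::real_normed_vector \<times> 'b::real_normed_vector \<Rightarrow> 'c::real_normed_vector"
  assumes "smooth_on (U \<times> S) F" "u \<in> U" "open S"
  shows "smooth_on S (\<lambda>s. F (u, s))"
proof -
  have "Ck_on k (U \<times> S) F \<Longrightarrow> Ck_on k S (\<lambda>s. F (u, s))" for k and F :: "'a \<times> 'b \<Rightarrow> 'c"
  proof (induction k arbitrary: F)
    case 0
    then show ?case
      using assms(2) by (auto intro!: continuous_on_compose2[of "U \<times> S" F] continuous_intros)
  next
    case (Suc k)
    have der: "((\<lambda>s. F (u, s)) has_derivative (\<lambda>v. frechet_derivative F (at (u, s)) (0, v))) (at s)"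
      if "s \<in> S" for s
    proof -
      have "(F has_derivative frechet_derivative F (at (u, s))) (at (u, s))"
        using Ck_on_SucD(1)[OF Suc.prems] that assms(2) by simp
      moreover have "((\<lambda>s. (u, s)) has_derivative (\<lambda>v. (0, v))) (at s)"
        by (intro has_derivative_Pair has_derivative_const has_derivative_ident)
      ultimately show ?thesis
        using has_derivative_compose[of "\<lambda>s. (u, s)" "\<lambda>v. (0, v)"] by blast
    qed
    show ?case
      by (rule Ck_on_SucI[OF assms(3) der]) (use Suc.IH Ck_on_SucD(2)[OF Suc.prems] in blast)+
  qed
  then show ?thesis using assms(1) by (simp add: smooth_on_def)
qed

section \<open>Smooth dependence of the solution of a linear system on its parameter\<close>

lemma has_vector_derivative_iff_tendsto:
  "(f has_vector_derivative D) (at t) \<longleftrightarrow> ((\<lambda>s. (f s - f t) /\<^sub>R (s - t)) \<longlongrightarrow> D) (at t)"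
proof -
  have "norm (f s - f t - (s - t) *\<^sub>R D) / norm (s - t) = norm ((f s - f t) /\<^sub>R (s - t) - D)"
    if "s \<noteq> t" for s
  proof -
    have "(f s - f t) /\<^sub>R (s - t) - D = (f s - f t - (s - t) *\<^sub>R D) /\<^sub>R (s - t)"
      using that by (simp add: scaleR_right_diff_distrib)
    then show ?thesis by (simp add: divide_inverse_commute)
  qed
  then have "((\<lambda>s. norm (f s - f t - (s - t) *\<^sub>R D) / norm (s - t)) \<longlongrightarrow> 0) (at t)
    \<longleftrightarrow> ((\<lambda>s. norm ((f s - f t) /\<^sub>R (s - t) - D)) \<longlongrightarrow> 0) (at t)"
    by (intro Lim_cong_within) auto
  then show ?thesis
    by (simp only: has_vector_derivative_def has_derivative_iff_norm tendsto_norm_zero_iff LIM_zero_iff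
        bounded_linear_scaleR_left simp_thms)
qed

text \<open>Differentiating the system \<open>W b \<bullet> z = y b\<close> gives the system \<open>W b \<bullet> z' = y b' - W b' \<bullet> z\<close>
  with the same coefficients, so regularity is gained one derivative at a time.\<close>

lemma Ck_on_linear_solution:
  fixes W :: "'a::euclidean_space \<Rightarrow> real \<Rightarrow> 'a"
  assumes J: "open J" and W: "\<And>b. b \<in> Basis \<Longrightarrow> smooth_on J (W b)"
    and bound: "\<And>s z. s \<in> J \<Longrightarrow> norm z \<le> C * (\<Sum>b\<in>Basis. \<bar>W b s \<bullet> z\<bar>)"
    and y: "\<And>b. b \<in> Basis \<Longrightarrow> Ck_on k J (\<lambda>s. W b s \<bullet> z s)"
  shows "Ck_on k J z"
  using y
proof (induction k arbitrary: z)
  case 0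
  define y where "y b s = W b s \<bullet> z s" for b s
  have y0: "continuous_on J (y b)" if "b \<in> Basis" for b
    using 0[OF that] by (simp add: y_def[abs_def])
  have "(z \<longlongrightarrow> z t) (at t)" if t: "t \<in> J" for t
  proof -
    \<comment> \<open>Apply \<open>bound\<close> to \<open>z s - z t\<close>. Its products with the
      coefficients are \<open>y b s - W b s \<bullet> z t\<close>, which tend to 0.\<close>
    have "((\<lambda>s. C * (\<Sum>b\<in>Basis. \<bar>y b s - W b s \<bullet> z t\<bar>))
        \<longlongrightarrow> C * (\<Sum>b\<in>Basis. \<bar>y b t - W b t \<bullet> z t\<bar>)) (at t)"
    proof (intro tendsto_mult tendsto_const tendsto_sum tendsto_rabs tendsto_diff tendsto_inner)
      fix b :: 'a assume b: "b \<in> Basis"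
      show "((\<lambda>s. y b s) \<longlongrightarrow> y b t) (at t)"
        using y0[OF b] J t by (simp add: continuous_on_eq_continuous_at continuous_at)
      show "(W b \<longlongrightarrow> W b t) (at t)"
        using smooth_on_continuous[OF W[OF b]] J t by (simp add: continuous_on_eq_continuous_at continuous_at)
    qed
    then have lim: "((\<lambda>s. C * (\<Sum>b\<in>Basis. \<bar>y b s - W b s \<bullet> z t\<bar>)) \<longlongrightarrow> 0) (at t)"
      by (simp add: y_def)
    have "\<forall>\<^sub>F s in at t. norm (z s - z t) \<le> C * (\<Sum>b\<in>Basis. \<bar>y b s - W b s \<bullet> z t\<bar>)"
      using eventually_at_in_open'[OF J t] bound
      by (auto elim!: eventually_mono simp: y_def inner_diff_right[symmetric])
    then show ?thesis
      by (rule LIM_zero_cancel[OF Lim_null_comparison[OF _ lim]])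
  qed
  then show ?case
    using J by (simp add: continuous_on_eq_continuous_at continuous_at)
next
  case (Suc k)
  define y where "y b s = W b s \<bullet> z s" for b s
  have y: "Ck_on (Suc k) J (y b)" if "b \<in> Basis" for b
    using Suc.prems[OF that] by (simp only: y_def[abs_def])
  have y': "(y b has_vector_derivative vector_derivative (y b) (at s)) (at s)"
    if "b \<in> Basis" "s \<in> J" for b s
    using y[OF that(1)] that(2) by (simp add: vector_derivative_works)
  have W': "(W b has_vector_derivative vector_derivative (W b) (at s)) (at s)"
    if "b \<in> Basis" "s \<in> J" for b s
    by (rule smooth_on_has_vector_derivative[OF W[OF that(1)] that(2)])
  have z: "Ck_on k J z"
    using Suc Ck_on_Suc_imp by blast
  have ex: "\<exists>D. (z has_vector_derivative D) (at t) \<and> (\<forall>b\<in>Basis. W b t \<bullet> D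
      = vector_derivative (y b) (at t) - vector_derivative (W b) (at t) \<bullet> z t)" if t: "t \<in> J" for t
  proof -
    \<comment> \<open>The coefficient map at \<open>t\<close>. By \<open>bound\<close> it is
      injective, hence surjective for reasons of dimension, so the formally differentiated system
      has a solution \<open>D\<close>, the candidate for the derivative.\<close>
    let ?L = "\<lambda>z. \<Sum>b\<in>Basis. (W b t \<bullet> z) *\<^sub>R b"
    have lin: "linear ?L"
      by (auto intro!: linearI simp: inner_add_right scaleR_add_left sum.distrib scaleR_sum_right)
    have L: "?L z \<bullet> b = W b t \<bullet> z" if "b \<in> Basis" for z b
      using that by simp
    have "z = 0" if "?L z = 0" for z
    proof -
      have "W b t \<bullet> z = 0" if "b \<in> Basis" for b
        using L[OF that, of z] \<open>?L z = 0\<close> by simp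
      then show ?thesis using bound[OF t, of z] by simp
    qed
    then have "inj ?L"
      using linear_injective_0[OF lin] by simp
    then have "surj ?L"
      using linear_injective_imp_surjective[OF lin] by simp
    then obtain D where D: "(\<Sum>b\<in>Basis.
        (vector_derivative (y b) (at t) - vector_derivative (W b) (at t) \<bullet> z t) *\<^sub>R b) = ?L D"
      by (rule surjE)
    have D: "W b t \<bullet> D = vector_derivative (y b) (at t) - vector_derivative (W b) (at t) \<bullet> z t"
      if "b \<in> Basis" for b
      using arg_cong[OF D, of "\<lambda>u. u \<bullet> b"] that by simp
    \<comment> \<open>The same estimate as for continuity, now for the difference quotient of
      \<open>z\<close> minus \<open>D\<close>. This bound tends to 0.\<close>
    have "((\<lambda>s. C * (\<Sum>b\<in>Basis. \<bar>(y b s - W b s \<bullet> z t) /\<^sub>R (s - t) - W b s \<bullet> D\<bar>))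
        \<longlongrightarrow> C * (\<Sum>b\<in>Basis. \<bar>W b t \<bullet> D - W b t \<bullet> D\<bar>)) (at t)"
    proof (intro tendsto_mult tendsto_const tendsto_sum tendsto_rabs tendsto_diff tendsto_inner)
      fix b :: 'a assume b: "b \<in> Basis"
      show "(W b \<longlongrightarrow> W b t) (at t)"
        using smooth_on_continuous[OF W[OF b]] J t by (simp add: continuous_on_eq_continuous_at continuous_at)
      have "((\<lambda>s. y b s - W b s \<bullet> z t) has_vector_derivative W b t \<bullet> D) (at t)"
        unfolding D[OF b]
        by (intro has_vector_derivative_diff y'[OF b t]
            bounded_linear.has_vector_derivative[OF bounded_linear_inner_left W'[OF b t]])
      then show "((\<lambda>s. (y b s - W b s \<bullet> z t) /\<^sub>R (s - t)) \<longlongrightarrow> W b t \<bullet> D) (at t)"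
        unfolding has_vector_derivative_iff_tendsto by (simp add: y_def)
    qed
    then have lim: "((\<lambda>s. C * (\<Sum>b\<in>Basis. \<bar>(y b s - W b s \<bullet> z t) /\<^sub>R (s - t) - W b s \<bullet> D\<bar>)) \<longlongrightarrow> 0) (at t)"
      by simp
    have "norm ((z s - z t) /\<^sub>R (s - t) - D)
       \<le> C * (\<Sum>b\<in>Basis. \<bar>(y b s - W b s \<bullet> z t) /\<^sub>R (s - t) - W b s \<bullet> D\<bar>)" if "s \<in> J" for s
      using bound[OF that, of "(z s - z t) /\<^sub>R (s - t) - D"]
      by (simp add: y_def inner_diff_right algebra_simps)
    then have "\<forall>\<^sub>F s in at t. norm ((z s - z t) /\<^sub>R (s - t) - D)
       \<le> C * (\<Sum>b\<in>Basis. \<bar>(y b s - W b s \<bullet> z t) /\<^sub>R (s - t) - W b s \<bullet> D\<bar>)"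
      using eventually_at_in_open'[OF J t] by (auto elim!: eventually_mono)
    then have "((\<lambda>s. (z s - z t) /\<^sub>R (s - t)) \<longlongrightarrow> D) (at t)"
      by (rule LIM_zero_cancel[OF Lim_null_comparison[OF _ lim]])
    then have "(z has_vector_derivative D) (at t)"
      by (simp add: has_vector_derivative_iff_tendsto)
    then show ?thesis using D by blast
  qed
  define z' where "z' t = vector_derivative z (at t)" for t
  have z': "(z has_vector_derivative z' t) (at t)"
    and Wz': "\<And>b. b \<in> Basis \<Longrightarrow> W b t \<bullet> z' t = vector_derivative (y b) (at t) - vector_derivative (W b) (at t) \<bullet> z t"
    if "t \<in> J" for t
    using ex[OF that] unfolding z'_def by (auto dest: vector_derivative_at)
  \<comment> \<open>\<open>z'\<close> solves a system with the same coefficients \<open>W\<close>,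
    whose right-hand side is C^k because \<open>z\<close> itself is already known to be C^k.\<close>
  have "Ck_on k J z'"
  proof (rule Suc.IH)
    fix b :: 'a assume b: "b \<in> Basis"
    have "Ck_on k J (\<lambda>s. vector_derivative (y b) (at s))"
      by (rule Ck_on_vector_derivative[OF J y[OF b]])
    moreover have "Ck_on k J (\<lambda>s. vector_derivative (W b) (at s))"
      using smooth_on_vector_derivative[OF J W[OF b]] unfolding smooth_on_def by blast
    ultimately have "Ck_on k J (\<lambda>s. vector_derivative (y b) (at s)
        + (-1) *\<^sub>R (vector_derivative (W b) (at s) \<bullet> z s))"
      by (intro Ck_on_add J bounded_bilinear.Ck_on[OF bounded_bilinear_inner]
          bounded_bilinear.Ck_on[OF bounded_bilinear_scaleR] Ck_on_const z)
    then show "Ck_on k J (\<lambda>s. W b s \<bullet> z' s)"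
      by (rule Ck_on_cong[OF J, THEN iffD1, rotated]) (simp add: Wz'[OF _ b])
  qed
  then have "Ck_on k J (\<lambda>s. v *\<^sub>R z' s)" for v
    by (intro bounded_bilinear.Ck_on[OF bounded_bilinear_scaleR J Ck_on_const])
  then show ?case
    using z' by (intro Ck_on_SucI[OF J, where D = "\<lambda>s v. v *\<^sub>R z' s"])
      (auto simp: has_vector_derivative_def)
qed

text \<open>By \<open>total\<close> the vectors \<open>w i t\<close> span for each \<open>t\<close>,
  so every basis vector is a finite combination of them. The same combination with constant
  coefficients gives nearby a square system \<open>W\<close> that is still uniformly invertible,
  even if \<open>K\<close> is infinite.\<close>

lemma smooth_on_linear_solution:
  fixes w :: "'i \<Rightarrow> real \<Rightarrow> 'a::euclidean_space"
  assumes S: "open S" and w: "\<And>i. i \<in> K \<Longrightarrow> smooth_on S (w i)"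
    and wz: "\<And>i. i \<in> K \<Longrightarrow> smooth_on S (\<lambda>s. w i s \<bullet> z s)"
    and total: "\<And>s v. s \<in> S \<Longrightarrow> (\<And>i. i \<in> K \<Longrightarrow> w i s \<bullet> v = 0) \<Longrightarrow> v = 0"
  shows "smooth_on S z"
proof -
  have "\<exists>U. open U \<and> t \<in> U \<and> Ck_on k U z" if t: "t \<in> S" for t k
  proof -
    have "span ((\<lambda>i. w i t) ` K) = UNIV"
    proof (rule ccontr)
      assume "span ((\<lambda>i. w i t) ` K) \<noteq> UNIV"
      then obtain v where v: "v \<noteq> 0" "\<And>u. u \<in> span ((\<lambda>i. w i t) ` K) \<Longrightarrow> orthogonal v u"
        using orthogonal_to_subspace_exists_gen[of "(\<lambda>i. w i t) ` K" UNIV] by auto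
      have "w i t \<bullet> v = 0" if "i \<in> K" for i
        using v(2)[of "w i t"] that by (simp add: span_base orthogonal_def inner_commute)
      then show False
        using total[OF t] v(1) by blast
    qed
    moreover have "\<exists>W. smooth_on S W \<and> smooth_on S (\<lambda>s. W s \<bullet> z s) \<and> W t = b"
      if "b \<in> span ((\<lambda>i. w i t) ` K)" for b
      using that
    proof (induction rule: span_induct_alt)
      case base
      show ?case
        by (rule exI[of _ "\<lambda>s. 0"]) (simp add: smooth_on_const)
    next
      case (step c x y)
      then obtain i W where "i \<in> K" "x = w i t" "smooth_on S W" "smooth_on S (\<lambda>s. W s \<bullet> z s)" "W t = y"
        by blast
      then show ?case
        using w[of i] wz[of i]
        by (intro exI[of _ "\<lambda>s. c *\<^sub>R w i s + W s"])
          (auto simp: inner_add_left simp flip: real_scaleR_def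
            intro!: S smooth_on_add smooth_on_scaleR smooth_on_const)
    qed
    ultimately have "\<forall>b. \<exists>W. smooth_on S W \<and> smooth_on S (\<lambda>s. W s \<bullet> z s) \<and> W t = b"
      by blast
    then obtain W where W: "\<And>b. smooth_on S (W b)" "\<And>b. smooth_on S (\<lambda>s. W b s \<bullet> z s)" "\<And>b. W b t = b"
      by metis
    have cont: "continuous_on S (\<lambda>s. \<Sum>b\<in>Basis. norm (W b s - b))"
      by (intro continuous_intros smooth_on_continuous W)
    \<comment> \<open>On \<open>J\<close> the rows \<open>W b s\<close> differ from the basis by
      less than 1/2 in total. The error in replacing \<open>b\<close> by \<open>W b s\<close> is
      then at most half of \<open>norm v\<close> and can be absorbed, which leads to the constant
      2.\<close>
    define J where "J = S \<inter> (\<lambda>s. \<Sum>b\<in>Basis. norm (W b s - b)) -` {..<1/2}"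
    have J: "open J"
      unfolding J_def by (rule continuous_open_preimage[OF cont S]) auto
    have "t \<in> J" using t by (simp add: J_def W)
    moreover have "norm v \<le> 2 * (\<Sum>b\<in>Basis. \<bar>W b s \<bullet> v\<bar>)" if "s \<in> J" for s v
    proof -
      have "norm v \<le> (\<Sum>b\<in>Basis. \<bar>v \<bullet> b\<bar>)"
        by (rule norm_le_l1)
      also have "\<dots> \<le> (\<Sum>b\<in>Basis. \<bar>W b s \<bullet> v\<bar> + norm (W b s - b) * norm v)"
      proof (rule sum_mono)
        fix b :: 'a
        have "\<bar>v \<bullet> b\<bar> = \<bar>W b s \<bullet> v - (W b s - b) \<bullet> v\<bar>"
          by (simp add: inner_diff_left inner_commute[of v b])
        also have "\<dots> \<le> \<bar>W b s \<bullet> v\<bar> + norm (W b s - b) * norm v"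
          using Cauchy_Schwarz_ineq2[of "W b s - b" v] by linarith
        finally show "\<bar>v \<bullet> b\<bar> \<le> \<dots>" .
      qed
      also have "\<dots> = (\<Sum>b\<in>Basis. \<bar>W b s \<bullet> v\<bar>) + (\<Sum>b\<in>Basis. norm (W b s - b)) * norm v"
        by (simp add: sum.distrib sum_distrib_right)
      also have "\<dots> \<le> (\<Sum>b\<in>Basis. \<bar>W b s \<bullet> v\<bar>) + 1/2 * norm v"
        using that by (intro add_left_mono mult_right_mono) (auto simp: J_def)
      finally show ?thesis by simp
    qed
    moreover have "J \<subseteq> S" by (auto simp: J_def)
    then have "smooth_on J (W b)" "Ck_on k J (\<lambda>s. W b s \<bullet> z s)" for b
      using W(1,2) Ck_on_subset unfolding smooth_on_def by blast+
    ultimately have "Ck_on k J z"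
      by (intro Ck_on_linear_solution[OF J, of W 2])
    then show ?thesis using J \<open>t \<in> J\<close> by blast
  qed
  then show ?thesis
    unfolding smooth_on_def by (auto intro!: Ck_on_local)
qed

section \<open>Charts and differentials\<close>

abbreviation rep_deriv :: "('m, 'e::euclidean_space) chart \<Rightarrow> ('m \<times> real \<Rightarrow> 'v::real_normed_vector) \<Rightarrow>
    'e \<times> real \<Rightarrow> 'e \<times> real \<Rightarrow> 'v" where
  "rep_deriv c F q \<equiv> frechet_derivative (local_rep c F) (at q)"

locale interval_product =
  fixes X :: "'m topology" and A :: "('m, 'e::euclidean_space) chart set" and I :: "real set"
  assumes manifold: "smooth_manifold X A" and open_I: "open I"
begin

lemma topspace_eq: "topspace X = (\<Union>c\<in>A. fst c)"
  using manifold by (simp add: smooth_manifold_def)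

lemma chart:
  assumes "c \<in> A"
  shows openin_chart: "openin X (fst c)" and open_chart_image: "open (chart_image c)"
    and homeomorphic_chart: "homeomorphic_map (subtopology X (fst c)) (top_of_set (chart_image c)) (snd c)"
  using assms manifold by (auto simp: smooth_manifold_def is_chart_def)

lemma topspace_chart: "c \<in> A \<Longrightarrow> topspace (subtopology X (fst c)) = fst c"
  using openin_subset[OF openin_chart, of c] by (auto simp: topspace_subtopology)

lemma inj_chart: "c \<in> A \<Longrightarrow> inj_on (snd c) (fst c)"
  using homeomorphic_imp_injective_map[OF homeomorphic_chart] topspace_chart by metis

lemma chart_inv_chart [simp]: "c \<in> A \<Longrightarrow> x \<in> fst c \<Longrightarrow> chart_inv c (snd c x) = x"
  by (simp add: chart_inv_def inj_chart)

lemma chart_chart_inv [simp]: "u \<in> chart_image c \<Longrightarrow> snd c (chart_inv c u) = u"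
  by (simp add: chart_inv_def chart_image_def f_inv_into_f)

lemma chart_inv_in [simp]: "u \<in> chart_image c \<Longrightarrow> chart_inv c u \<in> fst c"
  by (simp add: chart_inv_def chart_image_def inv_into_into)

lemma chart_in_image [simp]: "x \<in> fst c \<Longrightarrow> snd c x \<in> chart_image c"
  by (simp add: chart_image_def)

lemma local_rep_chart [simp]: "c \<in> A \<Longrightarrow> x \<in> fst c \<Longrightarrow> local_rep c F (snd c x, s) = F (x, s)"
  by (simp add: local_rep_def)

lemma openin_chart_preimage:
  assumes "c \<in> A" "open U"
  shows "openin X {x \<in> fst c. snd c x \<in> U}"
proof -
  have "continuous_map (subtopology X (fst c)) (top_of_set (chart_image c)) (snd c)"
    by (rule homeomorphic_imp_continuous_map[OF homeomorphic_chart[OF assms(1)]])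
  then have "openin (subtopology X (fst c)) {x \<in> topspace (subtopology X (fst c)). snd c x \<in> chart_image c \<inter> U}"
    using assms(2) by (intro openin_continuous_map_preimage[of _ "top_of_set (chart_image c)"])
      (auto simp: openin_open)
  then have "openin X {x \<in> fst c. snd c x \<in> chart_image c \<inter> U}"
    using openin_trans_full[OF _ openin_chart[OF assms(1)]] by (simp only: topspace_chart[OF assms(1)])
  moreover have "{x \<in> fst c. snd c x \<in> chart_image c \<inter> U} = {x \<in> fst c. snd c x \<in> U}"
    by auto
  ultimately show ?thesis by simp
qed

lemma open_overlap:
  assumes "c \<in> A" "d \<in> A"
  shows "open (snd c ` (fst c \<inter> fst d))"
proof -
  have "openin (subtopology X (fst c)) (fst c \<inter> fst d)"
    using openin_chart assms by (metis openin_subtopology_Int2)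
  then have "openin (top_of_set (chart_image c)) (snd c ` (fst c \<inter> fst d))"
    using homeomorphic_imp_open_map[OF homeomorphic_chart[OF assms(1)]] by (simp add: open_map_def)
  then show ?thesis
    using open_chart_image[OF assms(1)] openin_open_trans by blast
qed

lemma transition_chart [simp]: "c \<in> A \<Longrightarrow> x \<in> fst c \<Longrightarrow> transition c d (snd c x) = snd d x"
  by (simp add: transition_def)

lemma transition_has_derivative:
  assumes "c \<in> A" "d \<in> A" "x \<in> fst c" "x \<in> fst d"
  shows "(transition c d has_derivative frechet_derivative (transition c d) (at (snd c x))) (at (snd c x))"
proof -
  have "smooth_on (snd c ` (fst c \<inter> fst d)) (transition c d)"
    using assms manifold by (auto simp: smooth_manifold_def)
  then show ?thesis
    unfolding frechet_derivative_works[symmetric] using assms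
    by (intro smooth_on_differentiable) auto
qed

text \<open>The cocycle identity, by the chain rule. It makes the coordinate family
  \<open>coord_tvec\<close> a tangent vector.\<close>

lemma transition_chain:
  assumes "c \<in> A" "d \<in> A" "e \<in> A" "x \<in> fst c" "x \<in> fst d" "x \<in> fst e"
  shows "frechet_derivative (transition d e) (at (snd d x)) (frechet_derivative (transition c d) (at (snd c x)) v)
    = frechet_derivative (transition c e) (at (snd c x)) v"
proof -
  have "((\<lambda>u. transition d e (transition c d u)) has_derivative
      (\<lambda>v. frechet_derivative (transition d e) (at (snd d x)) (frechet_derivative (transition c d) (at (snd c x)) v)))
      (at (snd c x))"
    using has_derivative_compose[OF transition_has_derivative[of c d x], of "transition d e"]
      transition_has_derivative[of d e x] assms by simp
  moreover have "transition d e (transition c d u) = transition c e u" if "u \<in> snd c ` (fst c \<inter> fst d)" for u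
    using that assms by auto
  ultimately have der: "(transition c e has_derivative
      (\<lambda>v. frechet_derivative (transition d e) (at (snd d x)) (frechet_derivative (transition c d) (at (snd c x)) v)))
      (at (snd c x))"
    using has_derivative_transform_within_open[OF _ open_overlap[OF assms(1,2)]] assms by blast
  show ?thesis
    using fun_cong[OF frechet_derivative_at[OF der], of v] by simp
qed

lemma transition_self:
  assumes "c \<in> A" "x \<in> fst c"
  shows "frechet_derivative (transition c c) (at (snd c x)) v = v"
proof -
  have der: "(transition c c has_derivative (\<lambda>v. v)) (at (snd c x))"
    by (rule has_derivative_transform_within_open[OF has_derivative_ident open_chart_image[OF assms(1)]])
      (use assms in \<open>auto simp: transition_def\<close>)
  show ?thesis
    using fun_cong[OF frechet_derivative_at[OF der], of v] by simp
qed

lemma coord_tvec_self: "c \<in> A \<Longrightarrow> x \<in> fst c \<Longrightarrow> coord_tvec A c x v c = v"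
  by (simp add: coord_tvec_def transition_self)

lemma coord_tvec_tangent: "c \<in> A \<Longrightarrow> x \<in> fst c \<Longrightarrow> coord_tvec A c x v \<in> tangent_space A x"
  by (auto simp: tangent_space_def coord_tvec_def transition_chain)

lemma coord_tvec_zero: "c \<in> A \<Longrightarrow> x \<in> fst c \<Longrightarrow> coord_tvec A c x 0 = (\<lambda>_. 0)"
  using linear_0[OF has_derivative_linear[OF transition_has_derivative, of c _ x]]
  by (simp add: coord_tvec_def fun_eq_iff)

lemma coord_tvec_eq:
  assumes "c \<in> A" "x \<in> fst c" "V \<in> tangent_space A x"
  shows "coord_tvec A c x (V c) = V"
proof
  fix d
  show "coord_tvec A c x (V c) d = V d"
  proof (cases "d \<in> A \<and> x \<in> fst d")
    case True
    then have "V d = frechet_derivative (transition c d) (at (snd c x)) (V c)"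
      using assms unfolding tangent_space_def by blast
    then show ?thesis using True by (simp add: coord_tvec_def)
  next
    \<comment> \<open>Here the convention enters that a tangent vector has coordinate 0 in every
      chart not around the point.\<close>
    case False
    then have "V d = 0"
      using assms unfolding tangent_space_def by blast
    then show ?thesis using False by (simp only: coord_tvec_def if_False)
  qed
qed

lemma zero_tangent: "x \<in> topspace X \<Longrightarrow> (\<lambda>_. 0) \<in> tangent_space A x"
  using coord_tvec_tangent[of _ x 0] coord_tvec_zero by (auto simp: topspace_eq)

lemma chart_at:
  assumes "x \<in> topspace X"
  shows "chart_at A x \<in> A" "x \<in> fst (chart_at A x)"
proof -
  have "\<exists>c. c \<in> A \<and> x \<in> fst c"
    using assms unfolding topspace_eq by blast
  from someI_ex[OF this] show "chart_at A x \<in> A" "x \<in> fst (chart_at A x)"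
    by (simp_all add: chart_at_def)
qed

lemma in_topspace: "c \<in> A \<Longrightarrow> x \<in> fst c \<Longrightarrow> x \<in> topspace X"
  by (auto simp: topspace_eq)

lemma smooth_fun_rep: "smooth_fun A I F \<Longrightarrow> c \<in> A \<Longrightarrow> smooth_on (chart_image c \<times> I) (local_rep c F)"
  by (simp add: smooth_fun_def)

lemma rep_has_derivative:
  assumes "smooth_fun A I F" "c \<in> A" "u \<in> chart_image c" "s \<in> I"
  shows "(local_rep c F has_derivative rep_deriv c F (u, s)) (at (u, s))"
  using smooth_on_differentiable[OF smooth_fun_rep[OF assms(1,2)]] assms(3,4)
  by (simp add: frechet_derivative_works[symmetric])

text \<open>\<open>push\<close> reads the differential in one chosen chart. The chain rule for the
  transition map times the identity shows that every chart gives the same value.\<close>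

lemma rep_deriv_eq_push:
  assumes F: "smooth_fun A I F" and c: "c \<in> A" "x \<in> fst c" and s: "s \<in> I"
  shows "rep_deriv c F (snd c x, s) (v, t) = push A F (x, s) (coord_tvec A c x v, t)"
proof -
  define d where "d = chart_at A x"
  have d: "d \<in> A" "x \<in> fst d"
    using chart_at[of x] c by (auto simp: d_def topspace_eq)
  let ?T = "frechet_derivative (transition c d) (at (snd c x))"
  have "((\<lambda>(u, s). (transition c d u, s)) has_derivative (\<lambda>(v, t). (?T v, t))) (at (snd c x, s))"
    unfolding case_prod_beta
    using has_derivative_compose[OF has_derivative_fst[OF has_derivative_ident], of "transition c d" ?T "(snd c x, s)"]
      transition_has_derivative[of c d x] c d
    by (intro has_derivative_Pair has_derivative_snd has_derivative_ident) simp
  moreover have "(local_rep d F has_derivative rep_deriv d F (snd d x, s)) (at ((\<lambda>(u, s). (transition c d u, s)) (snd c x, s)))"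
    using rep_has_derivative[OF F d(1) _ s, of "snd d x"] c d by simp
  ultimately have "((\<lambda>q. local_rep d F ((\<lambda>(u, s). (transition c d u, s)) q)) has_derivative
      (\<lambda>q. rep_deriv d F (snd d x, s) ((\<lambda>(v, t). (?T v, t)) q))) (at (snd c x, s))"
    by (rule has_derivative_compose)
  moreover have "open (snd c ` (fst c \<inter> fst d) \<times> (UNIV :: real set))"
    using open_overlap[OF c(1) d(1)] by (intro open_Times) auto
  moreover have "(snd c x, s) \<in> snd c ` (fst c \<inter> fst d) \<times> UNIV"
    using c d by simp
  moreover have "local_rep d F ((\<lambda>(u, s). (transition c d u, s)) q) = local_rep c F q"
    if "q \<in> snd c ` (fst c \<inter> fst d) \<times> UNIV" for q
    using that c d by auto
  ultimately have der: "(local_rep c F has_derivative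
      (\<lambda>q. rep_deriv d F (snd d x, s) ((\<lambda>(v, t). (?T v, t)) q))) (at (snd c x, s))"
    by (rule has_derivative_transform_within_open)
  have "rep_deriv c F (snd c x, s) (v, t) = rep_deriv d F (snd d x, s) (?T v, t)"
    using fun_cong[OF frechet_derivative_at[OF der], of "(v, t)"] by simp
  then show ?thesis
    using d by (simp add: push_def coord_tvec_def d_def[symmetric])
qed

lemma rep_deriv_ds:
  assumes "smooth_fun A I F" "c \<in> A" "x \<in> fst c" "s \<in> I"
  shows "rep_deriv c F (snd c x, s) (0, t) = push A F (x, s) (\<lambda>_. 0, t)"
  using rep_deriv_eq_push[OF assms, of 0 t] coord_tvec_zero[OF assms(2,3)] by simp

lemma push_eq_rep_deriv:
  assumes "smooth_fun A I F" "c \<in> A" "x \<in> fst c" "s \<in> I" "V \<in> tangent_space A x"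
  shows "push A F (x, s) (V, t) = rep_deriv c F (snd c x, s) (V c, t)"
  using rep_deriv_eq_push[OF assms(1-4), of "V c" t] coord_tvec_eq[OF assms(2,3,5)] by simp

text \<open>A level set of \<open>h\<close> and its complement are both open, so on a connected
  space one of them is empty.\<close>

lemma locally_constant_imp_constant:
  assumes "connected_space X"
    and "\<And>c x. c \<in> A \<Longrightarrow> x \<in> fst c \<Longrightarrow> \<exists>U. open U \<and> snd c x \<in> U \<and> U \<subseteq> chart_image c \<and>
           (\<forall>u\<in>U. h (chart_inv c u) = h x)"
    and "x \<in> topspace X" "y \<in> topspace X"
  shows "h x = h y"
proof -
  have op: "openin X {z \<in> topspace X. P (h z)}" for P
  proof (subst openin_subopen, intro ballI)
    fix z assume z: "z \<in> {z \<in> topspace X. P (h z)}"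
    then obtain c where c: "c \<in> A" "z \<in> fst c"
      by (auto simp: topspace_eq)
    then obtain U where U: "open U" "snd c z \<in> U" "U \<subseteq> chart_image c" "\<forall>u\<in>U. h (chart_inv c u) = h z"
      using assms(2) by meson
    have "h y = h z" if "y \<in> fst c" "snd c y \<in> U" for y
      using U(4) that c(1) by (metis chart_inv_chart)
    moreover have "fst c \<subseteq> topspace X"
      using openin_subset[OF openin_chart[OF c(1)]] .
    ultimately have "{x \<in> fst c. snd c x \<in> U} \<subseteq> {z \<in> topspace X. P (h z)}"
      using z by auto
    then show "\<exists>T. openin X T \<and> z \<in> T \<and> T \<subseteq> {z \<in> topspace X. P (h z)}"
      using openin_chart_preimage[OF c(1) U(1)] U(2) c(2) by blast
  qed
  show ?thesis
  proof (rule ccontr)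
    assume "h x \<noteq> h y"
    then have "y \<in> {z \<in> topspace X. h z \<noteq> h x}" "x \<in> {z \<in> topspace X. h z = h x}"
      using assms(3,4) by auto
    moreover have "topspace X \<subseteq> {z \<in> topspace X. h z = h x} \<union> {z \<in> topspace X. h z \<noteq> h x}"
      "{z \<in> topspace X. h z = h x} \<inter> {z \<in> topspace X. h z \<noteq> h x} = {}" by auto
    ultimately show False
      using assms(1) op[of "\<lambda>k. k = h x"] op[of "\<lambda>k. k \<noteq> h x"] unfolding connected_space_def by blast
  qed
qed

end

section \<open>Hypersurfaces with a prescribed Gauss map\<close>

text \<open>The Leibniz rule for a constant function. It will be applied to the unit length of N, to
  the orthogonality of N and the s-derivative of the hypersurface, and to the distance from the
  centre of a sphere.\<close>

lemma inner_const_derivative: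
  assumes "open S" "q \<in> S" "(F has_derivative F') (at q)" "(G has_derivative G') (at q)"
    and "\<And>p. p \<in> S \<Longrightarrow> F p \<bullet> G p = k"
  shows "F q \<bullet> G' v + F' v \<bullet> G q = 0"
proof -
  have "((\<lambda>p. F p \<bullet> G p) has_derivative (\<lambda>v. F q \<bullet> G' v + F' v \<bullet> G q)) (at q)"
    by (rule has_derivative_inner[OF assms(3,4)])
  moreover have "((\<lambda>p. F p \<bullet> G p) has_derivative (\<lambda>v. 0)) (at q)"
    by (rule has_derivative_transform_within_open[OF has_derivative_const[of k] assms(1,2)])
      (simp add: assms(5))
  ultimately show ?thesis
    using has_derivative_unique by metis
qed

text \<open>The image of \<open>L\<close> has codimension 2, and \<open>p\<close>, \<open>q\<close>
  form an orthogonal basis of its complement, so a vector orthogonal to the image is the sum of its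
  projections to \<open>p\<close> and \<open>q\<close>.\<close>

lemma orthogonal_complement_decomposition:
  fixes L :: "'e::euclidean_space \<Rightarrow> 'v::euclidean_space"
  assumes dim: "DIM('v) = DIM('e) + 2" and L: "linear L" "\<And>v. L v = 0 \<Longrightarrow> v = 0"
    and pq: "p \<noteq> 0" "q \<noteq> 0" "p \<bullet> q = 0"
    and perp: "\<And>v. p \<bullet> L v = 0" "\<And>v. q \<bullet> L v = 0" "\<And>v. w \<bullet> L v = 0"
  shows "w = (w \<bullet> p / (p \<bullet> p)) *\<^sub>R p + (w \<bullet> q / (q \<bullet> q)) *\<^sub>R q"
proof -
  \<comment> \<open>Injective between spaces of equal dimension, hence onto. The defect
    \<open>x\<close> of the claimed formula is orthogonal to this range and so to itself.\<close>
  define \<Phi> where "\<Phi> = (\<lambda>(v, a, b). L v + (a *\<^sub>R p + b *\<^sub>R q))"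
  have lin: "linear \<Phi>"
    by (auto intro!: linearI simp: \<Phi>_def linear_add[OF L(1)] linear_scale[OF L(1)] algebra_simps)
  have "z = 0" if "\<Phi> z = 0" for z
  proof -
    obtain v a b where z: "z = (v, a, b)" by (cases z)
    have eq: "L v + (a *\<^sub>R p + b *\<^sub>R q) = 0" using that by (simp add: \<Phi>_def z)
    have "a = 0" using arg_cong[OF eq, of "\<lambda>x. p \<bullet> x"] pq perp by (simp add: inner_add_right)
    moreover have "b = 0" using arg_cong[OF eq, of "\<lambda>x. q \<bullet> x"] pq perp by (simp add: inner_add_right inner_commute)
    ultimately show ?thesis using eq L(2) by (simp add: z zero_prod_def)
  qed
  then have "inj \<Phi>" using linear_injective_0[OF lin] by simp
  then have "dim (range \<Phi>) = dim (UNIV :: ('e \<times> real \<times> real) set)"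
    using dim_image_eq[OF lin, of UNIV] by simp
  then have "dim (range \<Phi>) = DIM('v)" using dim by simp
  then have "span (range \<Phi>) = UNIV" using dim_eq_full by blast
  then have range: "range \<Phi> = UNIV"
    using linear_subspace_image[OF lin subspace_UNIV] by (metis span_eq_iff)
  define x where "x = w - ((w \<bullet> p / (p \<bullet> p)) *\<^sub>R p + (w \<bullet> q / (q \<bullet> q)) *\<^sub>R q)"
  have "x \<in> range \<Phi>" using range by simp
  then obtain v a b where "x = L v + (a *\<^sub>R p + b *\<^sub>R q)"
    by (auto simp: \<Phi>_def)
  moreover have "x \<bullet> L v = 0" for v
    by (simp add: x_def inner_diff_left inner_add_left perp)
  moreover have "x \<bullet> p = 0" "x \<bullet> q = 0"
    using pq by (simp_all add: x_def inner_diff_left inner_add_left inner_commute[of q p])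
  ultimately have "x \<bullet> x = 0" by (metis inner_add_right inner_scaleR_right mult_zero_right add_0)
  then show ?thesis by (simp add: x_def)
qed

text \<open>The orthogonal decomposition exists and is unique, so the description in
  \<open>normal_part\<close> really denotes the normal component.\<close>

lemma normal_part_eq_zero_imp_mem:
  assumes T: "subspace T" and "normal_part T v = 0"
  shows "v \<in> T"
proof -
  obtain y z where yz: "y \<in> span T" "\<And>w. w \<in> span T \<Longrightarrow> orthogonal z w" "v = y + z"
    using orthogonal_subspace_decomp_exists[of T v] by blast
  have zT: "v - z \<in> T \<and> (\<forall>u\<in>T. z \<bullet> u = 0)"
    using yz T by (auto simp: orthogonal_def span_base span_eq_iff[THEN iffD2])
  have uniq: "w = z" if "v - w \<in> T \<and> (\<forall>u\<in>T. w \<bullet> u = 0)" for w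
  proof -
    have "w - z = (v - z) - (v - w)" by simp
    then have "w - z \<in> T" using that zT subspace_diff[OF T] by metis
    then have "w \<bullet> (w - z) = 0" "z \<bullet> (w - z) = 0" using that zT by blast+
    then have "(w - z) \<bullet> (w - z) = 0" by (simp only: inner_diff_left diff_self)
    then show ?thesis by simp
  qed
  have "normal_part T v = z"
    unfolding normal_part_def by (rule the_equality) (rule zT, rule uniq)
  then have "z = 0" using assms(2) by simp
  then show ?thesis using zT by simp
qed

section \<open>Partial derivatives along the leaves and along the interval\<close>

context interval_product
begin

lemma prod_manifold_iff: "(x, s) \<in> prod_manifold A I \<longleftrightarrow> x \<in> topspace X \<and> s \<in> I"
  by (simp add: prod_manifold_def topspace_eq)

lemma rep_has_derivative_fst:
  assumes "smooth_fun A I F" "c \<in> A" "u \<in> chart_image c" "s \<in> I"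
  shows "((\<lambda>u. local_rep c F (u, s)) has_derivative (\<lambda>v. rep_deriv c F (u, s) (v, 0))) (at u)"
proof -
  have "((\<lambda>u. (u, s)) has_derivative (\<lambda>v. (v, 0))) (at u)"
    by (intro has_derivative_Pair has_derivative_const has_derivative_ident)
  from has_derivative_compose[OF this rep_has_derivative[OF assms]] show ?thesis .
qed

lemma rep_has_derivative_snd:
  assumes "smooth_fun A I F" "c \<in> A" "u \<in> chart_image c" "s \<in> I"
  shows "((\<lambda>s. local_rep c F (u, s)) has_vector_derivative rep_deriv c F (u, s) (0, 1)) (at s)"
proof -
  have "((\<lambda>s. (u, s)) has_derivative (\<lambda>t. (0, t))) (at s)"
    by (intro has_derivative_Pair has_derivative_const has_derivative_ident)
  from has_derivative_compose[OF this rep_has_derivative[OF assms]]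
  have der: "((\<lambda>s. local_rep c F (u, s)) has_derivative (\<lambda>t. rep_deriv c F (u, s) (0, t))) (at s)" .
  have lin: "rep_deriv c F (u, s) (0, t) = t *\<^sub>R rep_deriv c F (u, s) (0, 1)" for t
    using linear_scale[OF has_derivative_linear[OF rep_has_derivative[OF assms]], of t "(0, 1)"] by simp
  show ?thesis
    unfolding has_vector_derivative_def by (rule has_derivative_eq_rhs[OF der ext[OF lin]])
qed

lemma linear_rep_deriv:
  assumes "smooth_fun A I F" "c \<in> A" "u \<in> chart_image c" "s \<in> I"
  shows "linear (rep_deriv c F (u, s))" "linear (\<lambda>v. rep_deriv c F (u, s) (v, 0))"
  using has_derivative_linear[OF rep_has_derivative[OF assms]]
    has_derivative_linear[OF rep_has_derivative_fst[OF assms]] by auto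

lemma push_has_vector_derivative:
  assumes "smooth_fun A I F" "x \<in> topspace X" "s \<in> I"
  shows "((\<lambda>s. F (x, s)) has_vector_derivative push A F (x, s) d_s) (at s)"
proof -
  obtain c where c: "c \<in> A" "x \<in> fst c" using assms(2) chart_at by blast
  show ?thesis
    using rep_has_derivative_snd[OF assms(1) c(1) chart_in_image[OF c(2)] assms(3)] c
      rep_deriv_ds[OF assms(1) c assms(3)] by (simp add: d_s_def)
qed

end

text \<open>Collects what the form of the metric of N provides: N immerses each leaf, its
  s-derivative is orthogonal to the leaf and has length \<rho>. The leaf image thus has codimension
  2, with normal plane spanned by N and that derivative.\<close>

locale gauss_frame = interval_product X A I
  for X :: "'m topology" and A :: "('m, 'e::euclidean_space) chart set" and I :: "real set" +
  fixes N :: "'m \<times> real \<Rightarrow> 'v::euclidean_space" and \<rho> :: "'m \<times> real \<Rightarrow> real"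
  assumes dim_ambient: "DIM('v) = DIM('e) + 2"
    and connected: "connected_space X"
    and smooth_N: "smooth_fun A I N"
    and norm_N: "\<And>x s. x \<in> topspace X \<Longrightarrow> s \<in> I \<Longrightarrow> norm (N (x, s)) = 1"
    and N_orthogonal: "\<And>x s V. x \<in> topspace X \<Longrightarrow> s \<in> I \<Longrightarrow> V \<in> tangent_space A x \<Longrightarrow>
          push A N (x, s) (V, 0) \<bullet> push A N (x, s) d_s = 0"
    and N_injective: "\<And>x s V. x \<in> topspace X \<Longrightarrow> s \<in> I \<Longrightarrow> V \<in> tangent_space A x \<Longrightarrow>
          push A N (x, s) (V, 0) = 0 \<Longrightarrow> V = (\<lambda>_. 0)"
    and N_s_norm: "\<And>x s. x \<in> topspace X \<Longrightarrow> s \<in> I \<Longrightarrow>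
          push A N (x, s) d_s \<bullet> push A N (x, s) d_s = (\<rho> (x, s))\<^sup>2"
    and rho_pos: "\<And>x s. x \<in> topspace X \<Longrightarrow> s \<in> I \<Longrightarrow> 0 < \<rho> (x, s)"
begin

abbreviation N_s :: "'m \<times> real \<Rightarrow> 'v" where "N_s p \<equiv> push A N p d_s"

lemma N_s_nonzero: "x \<in> topspace X \<Longrightarrow> s \<in> I \<Longrightarrow> N_s (x, s) \<noteq> 0"
  using N_s_norm[of x s] rho_pos[of x s] by auto

lemma N_inner_N: "x \<in> topspace X \<Longrightarrow> s \<in> I \<Longrightarrow> N (x, s) \<bullet> N (x, s) = 1"
  using norm_N[of x s] by (simp add: norm_eq_1)

lemma N_nonzero: "x \<in> topspace X \<Longrightarrow> s \<in> I \<Longrightarrow> N (x, s) \<noteq> 0"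
  using norm_N[of x s] by auto

text \<open>Differentiate the identity \<open>N \<bullet> N = 1\<close>.\<close>

lemma N_perp_rep_deriv:
  assumes "c \<in> A" "x \<in> fst c" "s \<in> I"
  shows "N (x, s) \<bullet> rep_deriv c N (snd c x, s) w = 0"
proof -
  have "local_rep c N (snd c x, s) \<bullet> rep_deriv c N (snd c x, s) w
      + rep_deriv c N (snd c x, s) w \<bullet> local_rep c N (snd c x, s) = 0"
  proof (rule inner_const_derivative[where k = 1 and S = "chart_image c \<times> I"
        and F = "local_rep c N" and G = "local_rep c N" and q = "(snd c x, s)"])
    show "open (chart_image c \<times> I)"
      using open_chart_image[OF assms(1)] open_I by (rule open_Times)
    show "(snd c x, s) \<in> chart_image c \<times> I" using assms by simp
    show "local_rep c N p \<bullet> local_rep c N p = 1" if pq: "p \<in> chart_image c \<times> I" for p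
    proof -
      obtain u t where p: "p = (u, t)" "u \<in> chart_image c" "t \<in> I" using pq by (cases p) auto
      show ?thesis
        using N_inner_N[OF in_topspace[OF assms(1) chart_inv_in[OF p(2)]] p(3)]
        by (simp add: p(1) local_rep_def)
    qed
  qed (use rep_has_derivative[OF smooth_N assms(1)] assms in simp_all)
  then show ?thesis
    using assms by (simp add: inner_commute)
qed

lemma N_s_perp_rep_deriv:
  assumes "c \<in> A" "x \<in> fst c" "s \<in> I"
  shows "N_s (x, s) \<bullet> rep_deriv c N (snd c x, s) (v, 0) = 0"
  using N_orthogonal[OF in_topspace[OF assms(1,2)] assms(3) coord_tvec_tangent[OF assms(1,2)]]
    rep_deriv_eq_push[OF smooth_N assms] by (simp add: inner_commute)

lemma rep_deriv_N_injective:
  assumes "c \<in> A" "x \<in> fst c" "s \<in> I" "rep_deriv c N (snd c x, s) (v, 0) = 0"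
  shows "v = 0"
proof -
  have "coord_tvec A c x v = (\<lambda>_. 0)"
    using N_injective[OF in_topspace[OF assms(1,2)] assms(3) coord_tvec_tangent[OF assms(1,2)]]
      rep_deriv_eq_push[OF smooth_N assms(1-3)] assms(4) by simp
  then show ?thesis using coord_tvec_self[OF assms(1,2), of v] by simp
qed

lemma rep_deriv_N_s:
  assumes "c \<in> A" "x \<in> fst c" "s \<in> I"
  shows "rep_deriv c N (snd c x, s) (0, 1) = N_s (x, s)"
  using rep_deriv_ds[OF smooth_N assms] by (simp add: d_s_def)

lemma N_perp_N_s: "x \<in> topspace X \<Longrightarrow> s \<in> I \<Longrightarrow> N (x, s) \<bullet> N_s (x, s) = 0"
  using N_perp_rep_deriv[of "chart_at A x" x s] rep_deriv_N_s[of "chart_at A x" x s] chart_at by metis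

lemma perp_leaf_decomposition:
  assumes "c \<in> A" "x \<in> fst c" "s \<in> I" "\<And>v. w \<bullet> rep_deriv c N (snd c x, s) (v, 0) = 0"
  shows "w = (w \<bullet> N (x, s)) *\<^sub>R N (x, s) + (w \<bullet> N_s (x, s) / (\<rho> (x, s))\<^sup>2) *\<^sub>R N_s (x, s)"
proof -
  have x: "x \<in> topspace X" by (rule in_topspace[OF assms(1,2)])
  show ?thesis
    using orthogonal_complement_decomposition[OF dim_ambient
        linear_rep_deriv(2)[OF smooth_N assms(1) chart_in_image[OF assms(2)] assms(3)]
        rep_deriv_N_injective[OF assms(1-3)] N_nonzero[OF x assms(3)] N_s_nonzero[OF x assms(3)]
        N_perp_N_s[OF x assms(3)] N_perp_rep_deriv[OF assms(1-3)] N_s_perp_rep_deriv[OF assms(1-3)] assms(4)]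
    by (simp add: N_inner_N[OF x assms(3)] N_s_norm[OF x assms(3)])
qed

end

text \<open>\<open>h\<close> stands for each of the two hypersurfaces to be compared, which share
  the frame given by N.\<close>

locale enneper_hypersurface = gauss_frame X A I N \<rho>
  for X :: "'m topology" and A :: "('m, 'e::euclidean_space) chart set" and I :: "real set"
    and N :: "'m \<times> real \<Rightarrow> 'v::euclidean_space" and \<rho> :: "'m \<times> real \<Rightarrow> real" +
  fixes h :: "'m \<times> real \<Rightarrow> 'v"
  assumes enneper: "enneper_type A I h" and gauss: "gauss_map A I h N"
begin

lemma smooth_h: "smooth_fun A I h"
  using enneper by (simp add: enneper_type_def immersion_def)

lemma h_perp_N:
  assumes "c \<in> A" "x \<in> fst c" "s \<in> I"
  shows "N (x, s) \<bullet> rep_deriv c h (snd c x, s) w = 0"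
proof -
  have "(x, s) \<in> prod_manifold A I"
    using assms in_topspace by (simp add: prod_manifold_iff)
  then have "N (x, s) \<bullet> push A h (x, s) (coord_tvec A c x (fst w), snd w) = 0"
    using gauss coord_tvec_tangent[OF assms(1,2)] by (simp add: gauss_map_def prod_tangent_def)
  then show ?thesis
    using rep_deriv_eq_push[OF smooth_h assms, of "fst w" "snd w"] by simp
qed

lemma rep_deriv_h_injective:
  assumes "c \<in> A" "x \<in> fst c" "s \<in> I" "rep_deriv c h (snd c x, s) w = 0"
  shows "w = 0"
proof -
  have p: "(x, s) \<in> prod_manifold A I"
    using assms in_topspace by (simp add: prod_manifold_iff)
  then have inj: "inj_on (push A h (x, s)) (prod_tangent A (x, s))"
    using enneper by (simp add: enneper_type_def immersion_def)
  have "push A h (x, s) (coord_tvec A c x (fst w), snd w) = 0"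
    using rep_deriv_eq_push[OF smooth_h assms(1-3), of "fst w" "snd w"] assms(4) by simp
  moreover have "push A h (x, s) (coord_tvec A c x 0, 0) = 0"
    using rep_deriv_eq_push[OF smooth_h assms(1-3), of 0 0]
      linear_0[OF linear_rep_deriv(1)[OF smooth_h assms(1) chart_in_image[OF assms(2)] assms(3)]]
    by (simp add: zero_prod_def)
  ultimately have "(coord_tvec A c x (fst w), snd w) = (coord_tvec A c x 0, 0)"
    using inj coord_tvec_tangent[OF assms(1,2)] by (intro inj_onD[OF inj]) (simp_all add: prod_tangent_def)
  then have "fst w = 0" "snd w = 0"
    using coord_tvec_self[OF assms(1,2), of "fst w"] coord_tvec_self[OF assms(1,2), of 0] by simp_all
  then show ?thesis by (simp add: prod_eq_iff)
qed

text \<open>Since the second fundamental form is adapted, the mixed derivative of \<open>h\<close>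
  is tangent. Differentiating \<open>N \<bullet> h_s = 0\<close> along a leaf then makes
  \<open>h_s\<close> orthogonal to the image of the leaf under N. As \<open>h_s\<close> is also
  orthogonal to N, only the direction of \<open>N_s\<close> is left; the factor is nonzero because
  \<open>h\<close> is an immersion.\<close>

lemma h_s_parallel_N_s:
  assumes x: "x \<in> topspace X" and s: "s \<in> I"
  shows "\<exists>k. k \<noteq> 0 \<and> push A h (x, s) d_s = k *\<^sub>R N_s (x, s)"
proof -
  define c where "c = chart_at A x"
  have c: "c \<in> A" "x \<in> fst c" using chart_at[OF x] by (simp_all add: c_def)
  have p: "(x, s) \<in> prod_manifold A I" using x s by (simp add: prod_manifold_iff)
  let ?q = "(snd c x, s)"
  let ?hs = "\<lambda>q. rep_deriv c h q (0, 1)"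
  have u: "snd c x \<in> chart_image c" using c by simp
  have q: "open (chart_image c \<times> I)" "?q \<in> chart_image c \<times> I"
    using open_chart_image[OF c(1)] open_I u s by (simp_all add: open_Times)
  have hs: "push A h (x, s) d_s = ?hs ?q"
    using rep_deriv_ds[OF smooth_h c s] by (simp add: d_s_def)
  have perp: "?hs ?q \<bullet> rep_deriv c N ?q (v, 0) = 0" for v
  proof -
    let ?V = "(coord_tvec A c x v, 0)"
    let ?z = "frechet_derivative ?hs (at ?q) (v, 0)"
    let ?T = "push A h (x, s) ` prod_tangent A (x, s)"
    \<comment> \<open>Written as the range of a linear map, the tangent space is visibly a subspace,
      as the decomposition into tangent and normal part requires.\<close>
    have T: "?T = range (rep_deriv c h ?q)"
    proof
      show "?T \<subseteq> range (rep_deriv c h ?q)"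
        using push_eq_rep_deriv[OF smooth_h c s] by (auto simp: prod_tangent_def)
      show "range (rep_deriv c h ?q) \<subseteq> ?T"
        using rep_deriv_eq_push[OF smooth_h c s] coord_tvec_tangent[OF c]
        by (auto simp: prod_tangent_def image_iff)
    qed
    have "?V \<in> E0 A (x, s)" "d_s \<in> E1 (x, s)"
      using coord_tvec_tangent[OF c] by (simp_all add: E0_def E1_def d_s_def)
    then have "second_ff A h (x, s) ?V d_s = 0"
      using enneper p unfolding enneper_type_def by blast
    then have "normal_part ?T ?z = 0"
      by (simp add: second_ff_def c_def[symmetric] d_s_def coord_tvec_self[OF c])
    then have "?z \<in> ?T"
      unfolding T by (rule normal_part_eq_zero_imp_mem[OF linear_subspace_image[OF linear_rep_deriv(1)[OF smooth_h c(1) u s] subspace_UNIV]])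
    then have z: "N (x, s) \<bullet> ?z = 0"
      unfolding T using h_perp_N[OF c s] by auto
    \<comment> \<open>The Leibniz rule for \<open>N \<bullet> h_s = 0\<close>; its first summand
      vanishes by \<open>z\<close>.\<close>
    have "local_rep c N ?q \<bullet> ?z + rep_deriv c N ?q (v, 0) \<bullet> ?hs ?q = 0"
    proof (rule inner_const_derivative[where k = 0 and G = ?hs, OF q rep_has_derivative[OF smooth_N c(1) u s]])
      show "(?hs has_derivative frechet_derivative ?hs (at ?q)) (at ?q)"
        using smooth_on_differentiable[OF smooth_on_derivative[OF smooth_fun_rep[OF smooth_h c(1)]] q(2)]
        by (simp add: frechet_derivative_works[symmetric])
      show "local_rep c N p \<bullet> ?hs p = 0" if pq: "p \<in> chart_image c \<times> I" for p
      proof -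
        obtain u t where p: "p = (u, t)" "u \<in> chart_image c" "t \<in> I" using pq by (cases p) auto
        show ?thesis
          using h_perp_N[OF c(1) chart_inv_in[OF p(2)] p(3)] p(2) by (simp add: p(1) local_rep_def)
      qed
    qed
    then show ?thesis using z c by (simp add: inner_commute)
  qed
  have "?hs ?q = (?hs ?q \<bullet> N_s (x, s) / (\<rho> (x, s))\<^sup>2) *\<^sub>R N_s (x, s)"
    using perp_leaf_decomposition[OF c s perp] h_perp_N[OF c s, of "(0, 1)"] by (simp add: inner_commute)
  moreover have "?hs ?q \<noteq> 0"
    using rep_deriv_h_injective[OF c s, of "(0, 1)"] by (auto simp: zero_prod_def)
  ultimately show ?thesis
    unfolding hs by (metis scale_eq_0_iff)
qed

text \<open>Orthogonality of the net says this for \<open>h_s\<close>, which is a nonzero multiple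
  of \<open>N_s\<close>.\<close>

lemma h_perp_N_s:
  assumes "c \<in> A" "x \<in> fst c" "s \<in> I"
  shows "N_s (x, s) \<bullet> rep_deriv c h (snd c x, s) (v, 0) = 0"
proof -
  have x: "x \<in> topspace X" by (rule in_topspace[OF assms(1,2)])
  have "(coord_tvec A c x v, 0) \<in> E0 A (x, s)" "d_s \<in> E1 (x, s)" "(x, s) \<in> prod_manifold A I"
    using coord_tvec_tangent[OF assms(1,2)] x assms(3) by (simp_all add: E0_def E1_def d_s_def prod_manifold_iff)
  then have "induced_metric A h (x, s) (coord_tvec A c x v, 0) d_s = 0"
    using enneper unfolding enneper_type_def by blast
  moreover obtain k where "k \<noteq> 0" "push A h (x, s) d_s = k *\<^sub>R N_s (x, s)"
    using h_s_parallel_N_s[OF x assms(3)] by blast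
  ultimately show ?thesis
    using rep_deriv_eq_push[OF smooth_h assms, of v 0] by (simp add: induced_metric_def inner_commute)
qed

text \<open>At corresponding points the leaf of \<open>h\<close> has the same normal plane as its
  image under N, spanned by N and \<open>N_s\<close>.\<close>

lemma perp_leaf_decomposition_h:
  assumes "c \<in> A" "x \<in> fst c" "s \<in> I" "\<And>v. w \<bullet> rep_deriv c h (snd c x, s) (v, 0) = 0"
  shows "w = (w \<bullet> N (x, s)) *\<^sub>R N (x, s) + (w \<bullet> N_s (x, s) / (\<rho> (x, s))\<^sup>2) *\<^sub>R N_s (x, s)"
proof -
  have x: "x \<in> topspace X" by (rule in_topspace[OF assms(1,2)])
  have "v = 0" if "rep_deriv c h (snd c x, s) (v, 0) = 0" for v
    using rep_deriv_h_injective[OF assms(1-3) that] by (simp add: zero_prod_def)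
  then show ?thesis
    using orthogonal_complement_decomposition[OF dim_ambient
        linear_rep_deriv(2)[OF smooth_h assms(1) chart_in_image[OF assms(2)] assms(3)]
        _ N_nonzero[OF x assms(3)] N_s_nonzero[OF x assms(3)]
        N_perp_N_s[OF x assms(3)] h_perp_N[OF assms(1-3)] h_perp_N_s[OF assms(1-3)] assms(4)]
    by (simp add: N_inner_N[OF x assms(3)] N_s_norm[OF x assms(3)])
qed

end

section \<open>Functions that are constant along a leaf, and plane sections of the sphere\<close>

context gauss_frame
begin

lemma continuous_rep_deriv:
  assumes "smooth_fun A I F" "c \<in> A"
  shows "continuous_on (chart_image c \<times> I) (\<lambda>q. rep_deriv c F q w)"
  by (rule smooth_on_continuous[OF smooth_on_derivative[OF smooth_fun_rep[OF assms]]])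

lemma rho_eq_norm: "x \<in> topspace X \<Longrightarrow> s \<in> I \<Longrightarrow> \<rho> (x, s) = norm (N_s (x, s))"
  using N_s_norm[of x s] rho_pos[of x s] by (simp add: norm_eq_sqrt_inner)

text \<open>A continuous function with constant square takes at most two values, so it is constant
  on balls in charts and hence on the connected leaf. Here \<open>w\<close> will be the normal of a
  hyperplane or the position relative to the centre of a sphere.\<close>

lemma leaf_component_constant:
  assumes s: "s \<in> I"
    and cont: "\<And>c. c \<in> A \<Longrightarrow> continuous_on (chart_image c) (\<lambda>u. w (chart_inv c u))"
    and sq: "\<And>x. x \<in> topspace X \<Longrightarrow> (w x \<bullet> N_s (x, s) / \<rho> (x, s))\<^sup>2 = K"
    and xy: "x \<in> topspace X" "y \<in> topspace X"
  shows "w x \<bullet> N_s (x, s) / \<rho> (x, s) = w y \<bullet> N_s (y, s) / \<rho> (y, s)"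
proof (rule locally_constant_imp_constant[where h = "\<lambda>x. w x \<bullet> N_s (x, s) / \<rho> (x, s)", OF connected _ xy])
  fix c x assume c: "c \<in> A" "x \<in> fst c"
  let ?g = "\<lambda>u. w (chart_inv c u) \<bullet> N_s (chart_inv c u, s) / \<rho> (chart_inv c u, s)"
  let ?n = "\<lambda>u. rep_deriv c N (u, s) (0, 1)"
  have n: "N_s (chart_inv c u, s) = ?n u" if "u \<in> chart_image c" for u
    using rep_deriv_N_s[OF c(1) chart_inv_in[OF that] s] that by simp
  have top: "chart_inv c u \<in> topspace X" if "u \<in> chart_image c" for u
    by (rule in_topspace[OF c(1) chart_inv_in[OF that]])
  have "continuous_on (chart_image c) ?n"
    using s by (intro continuous_on_compose2[OF continuous_rep_deriv[OF smooth_N c(1)], of _ "\<lambda>u. (u, s)"]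
        continuous_intros) auto
  then have "continuous_on (chart_image c) (\<lambda>u. w (chart_inv c u) \<bullet> ?n u / norm (?n u))"
    using N_s_nonzero[OF top s] n by (intro continuous_intros cont[OF c(1)]) simp_all
  then have g: "continuous_on (chart_image c) ?g"
    by (rule continuous_on_eq) (simp add: rho_eq_norm[OF top s] n)
  obtain e where e: "0 < e" "ball (snd c x) e \<subseteq> chart_image c"
    using open_chart_image[OF c(1)] chart_in_image[OF c(2)] openE by blast
  have "?g u = sqrt K \<or> ?g u = - sqrt K" if "u \<in> ball (snd c x) e" for u
  proof -
    have "u \<in> chart_image c" using that e(2) by blast
    then have "sqrt K = \<bar>?g u\<bar>"
      using sq[OF top] by (metis real_sqrt_abs)
    then show ?thesis by linarith
  qed
  then have "?g ` ball (snd c x) e \<subseteq> {sqrt K, - sqrt K}" by blast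
  then have "finite (?g ` ball (snd c x) e)" by (rule finite_subset) simp
  then have "?g constant_on ball (snd c x) e"
    by (intro continuous_finite_range_constant continuous_on_subset[OF g e(2)]) simp
  then have "\<forall>u\<in>ball (snd c x) e. ?g u = ?g (snd c x)"
    using e(1) unfolding constant_on_def by (metis centre_in_ball)
  then show "\<exists>U. open U \<and> snd c x \<in> U \<and> U \<subseteq> chart_image c \<and>
      (\<forall>u\<in>U. ?g u = w x \<bullet> N_s (x, s) / \<rho> (x, s))"
    using e c by (intro exI[of _ "ball (snd c x) e"]) simp
qed

lemma zero_derivative_imp_constant:
  assumes der: "\<And>c u. c \<in> A \<Longrightarrow> u \<in> chart_image c \<Longrightarrow> ((\<lambda>u. h (chart_inv c u)) has_derivative (\<lambda>v. 0 :: real)) (at u)"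
    and xy: "x \<in> topspace X" "y \<in> topspace X"
  shows "h x = h y"
proof (rule locally_constant_imp_constant[where h = h, OF connected _ xy])
  fix c x assume c: "c \<in> A" "x \<in> fst c"
  obtain e where e: "0 < e" "ball (snd c x) e \<subseteq> chart_image c"
    using open_chart_image[OF c(1)] chart_in_image[OF c(2)] openE by blast
  have "\<exists>k. \<forall>u\<in>ball (snd c x) e. h (chart_inv c u) = k"
  proof (rule has_derivative_zero_constant[OF convex_ball])
    fix u assume "u \<in> ball (snd c x) e"
    then have "u \<in> chart_image c" using e(2) by blast
    then show "((\<lambda>u. h (chart_inv c u)) has_derivative (\<lambda>v. 0)) (at u within ball (snd c x) e)"
      by (rule has_derivative_at_withinI[OF der[OF c(1)]])
  qed
  then obtain k where k: "\<And>u. u \<in> ball (snd c x) e \<Longrightarrow> h (chart_inv c u) = k" by blast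
  have "snd c x \<in> ball (snd c x) e" using e(1) by simp
  then have "\<forall>u\<in>ball (snd c x) e. h (chart_inv c u) = h (chart_inv c (snd c x))"
    using k by presburger
  then show "\<exists>U. open U \<and> snd c x \<in> U \<and> U \<subseteq> chart_image c \<and> (\<forall>u\<in>U. h (chart_inv c u) = h x)"
    using e c by (intro exI[of _ "ball (snd c x) e"]) simp
qed

text \<open>Meant for contradictions: neither N nor a hypersurface can be constant on a leaf, since
  both have injective differential there.\<close>

lemma constant_leaf_rep_deriv:
  assumes "smooth_fun A I F" "c \<in> A" "x \<in> fst c" "s \<in> I"
    and const: "\<And>x. x \<in> topspace X \<Longrightarrow> F (x, s) = k"
  shows "rep_deriv c F (snd c x, s) (v, 0) = 0"
proof -
  have "((\<lambda>u. local_rep c F (u, s)) has_derivative (\<lambda>v. 0)) (at (snd c x))"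
    by (rule has_derivative_transform_within_open[OF has_derivative_const[of k] open_chart_image[OF assms(2)]])
      (use assms(3) const in_topspace[OF assms(2)] in \<open>auto simp: local_rep_def\<close>)
  from has_derivative_unique[OF this rep_has_derivative_fst[OF assms(1,2) chart_in_image[OF assms(3)] assms(4)]]
  show ?thesis by metis
qed

text \<open>Near \<open>(x0, s0)\<close> the height \<open>v \<bullet> N\<close> is strictly monotone in \<open>s\<close>, so it takes the value \<open>k\<close>
  only on the leaf.\<close>

lemma leaf_open_in_plane_section:
  assumes diffeo: "local_diffeo_sphere X A I N" and x0: "x0 \<in> topspace X" and s0: "s0 \<in> I"
    and plane: "\<And>x. x \<in> topspace X \<Longrightarrow> v \<bullet> N (x, s0) = k"
    and transversal: "v \<bullet> N_s (x0, s0) \<noteq> 0"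
  shows "\<exists>V. open V \<and> N (x0, s0) \<in> V \<and>
    (\<forall>y\<in>V. norm y = 1 \<longrightarrow> v \<bullet> y = k \<longrightarrow> (\<exists>x\<in>topspace X. y = N (x, s0)))"
proof -
  have "(x0, s0) \<in> prod_manifold A I" using x0 s0 by (simp add: prod_manifold_iff)
  then obtain c W where c: "c \<in> A" and W: "(x0, s0) \<in> W" "W \<subseteq> fst c \<times> I"
      "inj_on N W" "openin (top_of_set (sphere 0 1)) (N ` W)"
      and inverse: "smooth_on_subset (N ` W) (\<lambda>y. map_prod (snd c) id (inv_into W N y))"
    using diffeo unfolding local_diffeo_sphere_def by meson
  let ?G = "\<lambda>y. map_prod (snd c) id (inv_into W N y)"
  have x0c: "x0 \<in> fst c" using W by auto
  \<comment> \<open>By continuity the s-derivative of the height stays nonzero on a box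
    \<open>B \<times> J\<close> of chart coordinates around the point.\<close>
  have "open {q \<in> chart_image c \<times> I. v \<bullet> rep_deriv c N q (0, 1) \<in> - {0}}"
    using open_chart_image[OF c] open_I
    by (intro continuous_open_preimage[unfolded vimage_def Int_def mem_Collect_eq] continuous_intros
        continuous_rep_deriv smooth_N c open_Times) auto
  moreover have "(snd c x0, s0) \<in> {q \<in> chart_image c \<times> I. v \<bullet> rep_deriv c N q (0, 1) \<in> - {0}}"
    using x0c s0 transversal rep_deriv_N_s[OF c x0c s0] by simp
  ultimately obtain B J where BJ: "open B" "open J" "(snd c x0, s0) \<in> B \<times> J"
      "B \<times> J \<subseteq> {q \<in> chart_image c \<times> I. v \<bullet> rep_deriv c N q (0, 1) \<in> - {0}}"
    by (rule open_prod_elim)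
  obtain e where e: "0 < e" "ball s0 e \<subseteq> J"
    using BJ(2,3) openE by blast
  \<comment> \<open>By the mean value theorem two points with equal height on one s-line in the box
    would enclose a zero of the s-derivative.\<close>
  have inj: "s = t" if "u \<in> B" "s \<in> ball s0 e" "t \<in> ball s0 e"
    "v \<bullet> local_rep c N (u, s) = k" "v \<bullet> local_rep c N (u, t) = k" for u s t
  proof -
    have no: False if "a < b" "a \<in> ball s0 e" "b \<in> ball s0 e" "v \<bullet> local_rep c N (u, a) = v \<bullet> local_rep c N (u, b)" for a b
    proof -
      have t: "t \<in> ball s0 e" if "a \<le> t" "t \<le> b" for t
        using that \<open>a \<in> ball s0 e\<close> \<open>b \<in> ball s0 e\<close> by (auto simp: dist_real_def)
      have "((\<lambda>t. v \<bullet> local_rep c N (u, t)) has_real_derivative v \<bullet> rep_deriv c N (u, t) (0, 1)) (at t)"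
        if "a \<le> t" "t \<le> b" for t
      proof -
        have "(u, t) \<in> B \<times> J"
          using t[OF that] \<open>u \<in> B\<close> e(2) by blast
        then have "u \<in> chart_image c" "t \<in> I"
          using BJ(4) by auto
        then show ?thesis
          unfolding has_real_derivative_iff_has_vector_derivative
          by (intro bounded_linear.has_vector_derivative[OF bounded_linear_inner_right]
              rep_has_derivative_snd smooth_N c)
      qed
      then obtain t where "a < t" "t < b"
        "v \<bullet> local_rep c N (u, b) - v \<bullet> local_rep c N (u, a) = (b - a) * (v \<bullet> rep_deriv c N (u, t) (0, 1))"
        using MVT2[OF \<open>a < b\<close>, of "\<lambda>t. v \<bullet> local_rep c N (u, t)" "\<lambda>t. v \<bullet> rep_deriv c N (u, t) (0, 1)"] by blast
      moreover have "v \<bullet> rep_deriv c N (u, t) (0, 1) \<noteq> 0"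
      proof -
        have "(u, t) \<in> B \<times> J"
          using t[of t] \<open>a < t\<close> \<open>t < b\<close> \<open>u \<in> B\<close> e(2) by auto
        then show ?thesis using BJ(4) by blast
      qed
      ultimately show False using that(1,4) by simp
    qed
    show ?thesis
      using no[of s t] no[of t s] that by (cases s t rule: linorder_cases) auto
  qed
  obtain V1 G where V1: "open V1" "N (x0, s0) \<in> V1" "smooth_on V1 G" "\<forall>z\<in>N ` W \<inter> V1. G z = ?G z"
    using bspec[OF inverse[unfolded smooth_on_subset_def] imageI[OF W(1)]] by (elim exE conjE)
  obtain O1 where O1: "open O1" "N ` W = sphere 0 1 \<inter> O1"
    using W(4) unfolding openin_open by blast
  define V where "V = (V1 \<inter> G -` (B \<times> ball s0 e)) \<inter> O1"
  have "open V"
    unfolding V_def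
    by (intro open_Int O1(1) continuous_open_preimage smooth_on_continuous[OF V1(3)] V1(1) open_Times BJ(1)) simp
  moreover have "N (x0, s0) \<in> V"
  proof -
    have NW: "N (x0, s0) \<in> N ` W" using W(1) by (rule imageI)
    have "G (N (x0, s0)) = (snd c x0, s0)"
      using V1(4) NW V1(2) inv_into_f_f[OF W(3,1)] by simp
    then show ?thesis
      using NW V1(2) BJ(3) e(1) by (simp add: V_def O1(2))
  qed
  moreover have "\<exists>x\<in>topspace X. y = N (x, s0)" if y: "y \<in> V" "norm y = 1" "v \<bullet> y = k" for y
  proof -
    have yW: "y \<in> N ` W" using y O1(2) by (simp add: V_def)
    obtain x s where q: "inv_into W N y = (x, s)" by (cases "inv_into W N y")
    have xs: "(x, s) \<in> W" "N (x, s) = y"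
      using inv_into_into[OF yW] f_inv_into_f[OF yW] q by auto
    then have x: "x \<in> fst c" using W(2) by auto
    have "G y = ?G y" using y(1) V1(4) yW by (simp add: V_def)
    then have "?G y \<in> B \<times> ball s0 e"
      using y(1) by (simp add: V_def)
    then have us: "snd c x \<in> B" "s \<in> ball s0 e" by (simp_all add: q)
    \<comment> \<open>\<open>(x, s)\<close> and \<open>(x, s0)\<close> both have height
      \<open>k\<close>, the latter by \<open>plane\<close>.\<close>
    have "s = s0"
      using inj[OF us(1,2), of s0] e(1) x y(3) xs(2) c plane[OF in_topspace[OF c x]] by simp
    then show ?thesis using xs(2) in_topspace[OF c x] by blast
  qed
  ultimately show ?thesis by blast
qed

end

section \<open>Leaves with planar Gauss image, and the normal form of a leaf\<close>

context enneper_hypersurface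
begin

text \<open>If \<open>N\<close> maps the leaf into a hyperplane \<open>v \<bullet> y = k\<close>, then \<open>v = k N + m \<rho>\<^sup>-\<^sup>1 N\<^sub>s\<close> with a constant
  \<open>m\<close>, and eliminating \<open>N\<^sub>s\<close> exhibits the leaf as a homothetic copy of an open part of a small
  sphere.\<close>

lemma planar_leaf_imp_round:
  assumes diffeo: "local_diffeo_sphere X A I N" and x0: "x0 \<in> topspace X" and s: "s \<in> I"
    and form: "\<And>x. x \<in> topspace X \<Longrightarrow> h (x, s) = P + a *\<^sub>R N (x, s) + (b * inverse (\<rho> (x, s))) *\<^sub>R N_s (x, s)"
    and v: "v \<noteq> 0" and plane: "\<And>x. x \<in> topspace X \<Longrightarrow> v \<bullet> N (x, s) = k"
  shows "\<exists>S. round_sphere_codim2 S \<and> openin (top_of_set S) (h ` leaf A s)"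
proof -
  obtain c0 where c0: "c0 \<in> A" "x0 \<in> fst c0" using x0 chart_at by blast
  obtain b0 :: 'e where b0: "b0 \<in> Basis" using nonempty_Basis by blast
  have perp: "v \<bullet> rep_deriv c N (snd c x, s) (w, 0) = 0" if "c \<in> A" "x \<in> fst c" for c x w
  proof -
    have "v \<bullet> rep_deriv c N (snd c x, s) (w, 0) + 0 \<bullet> local_rep c N (snd c x, s) = 0"
      by (rule inner_const_derivative[where F = "\<lambda>u. v" and k = k and F' = "\<lambda>_. 0" and q = "snd c x" and S = "chart_image c"
            and G = "\<lambda>u. local_rep c N (u, s)" and G' = "\<lambda>w. rep_deriv c N (snd c x, s) (w, 0)",
            OF open_chart_image[OF that(1)] chart_in_image[OF that(2)] has_derivative_const
            rep_has_derivative_fst[OF smooth_N that(1) chart_in_image[OF that(2)] s]])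
        (use plane in_topspace[OF that(1) chart_inv_in] in \<open>simp add: local_rep_def\<close>)
    then show ?thesis by simp
  qed
  \<comment> \<open>The component of \<open>v\<close> along the unit vector
    \<open>N_s / \<rho>\<close>. Its square is \<open>v \<bullet> v - k\<^sup>2\<close>, so it is
    constant on the leaf.\<close>
  define \<sigma> where "\<sigma> x = v \<bullet> N_s (x, s) / \<rho> (x, s)" for x
  have decomp: "v = k *\<^sub>R N (x, s) + (\<sigma> x / \<rho> (x, s)) *\<^sub>R N_s (x, s)" if "x \<in> topspace X" for x
    using perp_leaf_decomposition[of "chart_at A x" x s v] chart_at[OF that] perp s plane[OF that]
    by (simp add: \<sigma>_def power2_eq_square)
  have sq: "(\<sigma> x)\<^sup>2 = v \<bullet> v - k\<^sup>2" if "x \<in> topspace X" for x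
  proof -
    have "v \<bullet> v = v \<bullet> (k *\<^sub>R N (x, s) + (\<sigma> x / \<rho> (x, s)) *\<^sub>R N_s (x, s))"
      using decomp[OF that] by simp
    also have "\<dots> = k\<^sup>2 + (\<sigma> x)\<^sup>2"
      by (simp only: inner_add_right inner_scaleR_right plane[OF that]) (simp add: \<sigma>_def power2_eq_square)
    finally show ?thesis by simp
  qed
  define m where "m = \<sigma> x0"
  have \<sigma>: "\<sigma> x = m" if "x \<in> topspace X" for x
    unfolding \<sigma>_def m_def
    by (rule leaf_component_constant[OF s _ sq[unfolded \<sigma>_def] that x0]) simp_all
  have m2: "m\<^sup>2 = v \<bullet> v - k\<^sup>2" using sq[OF x0] by (simp add: m_def)
  \<comment> \<open>Otherwise \<open>v = k N\<close>, and N would be constant on the leaf.\<close>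
  have m: "m \<noteq> 0"
  proof
    assume "m = 0"
    then have kN: "v = k *\<^sub>R N (x, s)" if "x \<in> topspace X" for x
      using decomp[OF that] \<sigma>[OF that] by simp
    then have "k \<noteq> 0" using v x0 by auto
    then have "N (x, s) = v /\<^sub>R k" if "x \<in> topspace X" for x
      using kN[OF that] by (metis scaleR_left_imp_eq scaleR_scaleR right_inverse scaleR_one)
    then have "rep_deriv c0 N (snd c0 x0, s) (b0, 0) = 0"
      by (intro constant_leaf_rep_deriv[OF smooth_N c0 s])
    then show False
      using rep_deriv_N_injective[OF c0 s, of b0] nonzero_Basis[OF b0] by simp
  qed
  \<comment> \<open>Substitute \<open>N_s / \<rho> = (v - k N) / m\<close> into \<open>form\<close>;
    \<open>Q\<close> collects the constant terms and \<open>q\<close> is the coefficient of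
    N.\<close>
  define q where "q = a - b * k / m"
  define Q where "Q = P + (b / m) *\<^sub>R v"
  have hN: "h (x, s) = Q + q *\<^sub>R N (x, s)" if "x \<in> topspace X" for x
  proof -
    have "(b / m) *\<^sub>R v = (b / m) *\<^sub>R (k *\<^sub>R N (x, s) + (m / \<rho> (x, s)) *\<^sub>R N_s (x, s))"
      using arg_cong[OF decomp[OF that], of "scaleR (b / m)"] by (simp only: \<sigma>[OF that])
    also have "\<dots> = (b / m * k) *\<^sub>R N (x, s) + (b * inverse (\<rho> (x, s))) *\<^sub>R N_s (x, s)"
      using m by (simp add: scaleR_add_right divide_inverse)
    finally have "(b / m) *\<^sub>R v = (b / m * k) *\<^sub>R N (x, s) + (b * inverse (\<rho> (x, s))) *\<^sub>R N_s (x, s)" .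
    then show ?thesis
      by (simp add: form[OF that] Q_def q_def algebra_simps)
  qed
  have q: "q \<noteq> 0"
  proof
    assume "q = 0"
    then have "rep_deriv c0 h (snd c0 x0, s) (b0, 0) = 0"
      by (intro constant_leaf_rep_deriv[OF smooth_h c0 s, of Q]) (simp add: hN)
    then show False
      using rep_deriv_h_injective[OF c0 s, of "(b0, 0)"] nonzero_Basis[OF b0] by (simp add: zero_prod_def)
  qed
  have vv: "0 < v \<bullet> v" using v by simp
  \<comment> \<open>The small sphere cut out by \<open>v \<bullet> y = k\<close> has centre
    \<open>k v / (v \<bullet> v)\<close> and, by \<open>m2\<close>, radius
    \<open>\<bar>m\<bar> / norm v\<close>. Its image under the homothety sending y to
    \<open>Q + q y\<close> has centre \<open>c\<close> and radius \<open>r\<close>.\<close>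
  define c where "c = Q + (q * k / (v \<bullet> v)) *\<^sub>R v"
  define r where "r = \<bar>q * m\<bar> / norm v"
  define S where "S = {y \<in> sphere c r. (y - c) \<bullet> v = 0}"
  have "round_sphere_codim2 S"
    unfolding round_sphere_codim2_def S_def using q m v by (intro exI[of _ c] exI[of _ r] exI[of _ v]) (simp add: r_def)
  moreover have S_iff: "Q + q *\<^sub>R y \<in> S \<longleftrightarrow> norm y = 1 \<and> v \<bullet> y = k" for y
  proof -
    have yc: "Q + q *\<^sub>R y - c = q *\<^sub>R (y - (k / (v \<bullet> v)) *\<^sub>R v)"
      by (simp add: c_def algebra_simps)
    have "(Q + q *\<^sub>R y - c) \<bullet> v = q * (v \<bullet> y - k)"
      using vv v by (simp add: yc inner_diff_left inner_diff_right inner_commute)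
    then have perp_iff: "(Q + q *\<^sub>R y - c) \<bullet> v = 0 \<longleftrightarrow> v \<bullet> y = k" using q by simp
    have "dist c (Q + q *\<^sub>R y) = r \<longleftrightarrow> norm y = 1" if y: "v \<bullet> y = k"
    proof -
      have "dist c (Q + q *\<^sub>R y) = r \<longleftrightarrow> (norm (Q + q *\<^sub>R y - c))\<^sup>2 = r\<^sup>2"
        by (simp add: dist_norm norm_minus_commute[of c] power2_eq_iff_nonneg r_def)
      also have "(norm (Q + q *\<^sub>R y - c))\<^sup>2 = q\<^sup>2 * (y \<bullet> y - k\<^sup>2 / (v \<bullet> v))"
        unfolding yc norm_scaleR power_mult_distrib power2_abs power2_norm_eq_inner using y vv
        by (simp add: inner_diff_left inner_diff_right inner_commute[of y v] power2_eq_square)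
      also have "r\<^sup>2 = q\<^sup>2 * (1 - k\<^sup>2 / (v \<bullet> v))"
      proof -
        have "r\<^sup>2 = q\<^sup>2 * ((v \<bullet> v - k\<^sup>2) / (v \<bullet> v))"
          by (simp add: r_def power_divide power_mult_distrib power2_norm_eq_inner m2)
        also have "(v \<bullet> v - k\<^sup>2) / (v \<bullet> v) = 1 - k\<^sup>2 / (v \<bullet> v)"
          using vv by (simp add: diff_divide_distrib)
        finally show ?thesis .
      qed
      finally show ?thesis using q by (simp add: norm_eq_1)
    qed
    then show ?thesis
      using perp_iff by (auto simp: S_def)
  qed
  moreover have "openin (top_of_set S) (h ` leaf A s)"
  proof (subst openin_subopen, intro ballI)
    fix z assume "z \<in> h ` leaf A s"
    then obtain x where x: "x \<in> topspace X" and z: "z = h (x, s)"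
      by (auto simp: leaf_def topspace_eq)
    have "v \<bullet> N_s (x, s) \<noteq> 0" using \<sigma>[OF x] m by (auto simp: \<sigma>_def)
    then obtain V where V: "open V" "N (x, s) \<in> V"
        "\<And>y. y \<in> V \<Longrightarrow> norm y = 1 \<Longrightarrow> v \<bullet> y = k \<Longrightarrow> \<exists>x\<in>topspace X. y = N (x, s)"
      using leaf_open_in_plane_section[OF diffeo x s plane] by blast
    \<comment> \<open>The image of \<open>V\<close> under that homothety. Near \<open>z\<close>
      every point of \<open>S\<close> therefore comes from the leaf.\<close>
    define U where "U = (\<lambda>y. (y - Q) /\<^sub>R q) -` V"
    have "open U"
      unfolding U_def by (intro open_vimage V(1) continuous_intros)
    moreover have "z \<in> S" "z \<in> U"
      using x V(2) norm_N[OF x s] plane[OF x] q by (simp_all add: z hN S_iff U_def)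
    moreover have "y \<in> h ` leaf A s" if yS: "y \<in> S" and yU: "y \<in> U" for y
    proof -
      have y: "y = Q + q *\<^sub>R ((y - Q) /\<^sub>R q)" using q by simp
      then have "norm ((y - Q) /\<^sub>R q) = 1 \<and> v \<bullet> ((y - Q) /\<^sub>R q) = k"
        using yS S_iff by metis
      then obtain x' where "x' \<in> topspace X" "(y - Q) /\<^sub>R q = N (x', s)"
        using V(3)[of "(y - Q) /\<^sub>R q"] yU by (auto simp: U_def)
      then have "x' \<in> topspace X" "y = h (x', s)"
        using hN y by auto
      then show ?thesis by (auto simp: leaf_def topspace_eq)
    qed
    ultimately show "\<exists>T. openin (top_of_set S) T \<and> z \<in> T \<and> T \<subseteq> h ` leaf A s"
      by (intro exI[of _ "S \<inter> U"]) (auto simp: openin_open)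
  qed
  ultimately show ?thesis by blast
qed

text \<open>The position relative to the centre of the sphere is orthogonal to the leaf, hence a
  combination of N and \<open>N_s / \<rho>\<close>. The first coefficient has zero derivative along
  the leaf; the second then has constant square, hence is constant by connectedness.\<close>

lemma leaf_form:
  assumes s: "s \<in> I"
  shows "\<exists>c a b. \<forall>x\<in>topspace X. h (x, s) = c + a *\<^sub>R N (x, s) + (b * inverse (\<rho> (x, s))) *\<^sub>R N_s (x, s)"
proof (cases "topspace X = {}")
  case True
  then show ?thesis by simp
next
  case False
  then obtain x0 where x0: "x0 \<in> topspace X" by blast
  obtain z r where "h ` leaf A s \<subseteq> sphere z r"
    using enneper s unfolding enneper_type_def by blast
  then have sphere: "norm (h (x, s) - z) = r" if "x \<in> topspace X" for x
    using that by (auto simp: leaf_def topspace_eq dist_norm norm_minus_commute image_subset_iff)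
  define w where "w x = h (x, s) - z" for x
  have ww: "w x \<bullet> w x = r\<^sup>2" if "x \<in> topspace X" for x
    using sphere[OF that] by (simp add: w_def power2_norm_eq_inner[symmetric])
  have dw: "((\<lambda>u. w (chart_inv c u)) has_derivative (\<lambda>v. rep_deriv c h (u, s) (v, 0))) (at u)"
    if "c \<in> A" "u \<in> chart_image c" for c u
    using has_derivative_diff[OF rep_has_derivative_fst[OF smooth_h that s] has_derivative_const[of z]]
    by (simp add: w_def local_rep_def)
  have perp: "w x \<bullet> rep_deriv c h (snd c x, s) (v, 0) = 0" if c: "c \<in> A" "x \<in> fst c" for c x v
  proof -
    have "w (chart_inv c (snd c x)) \<bullet> rep_deriv c h (snd c x, s) (v, 0)
        + rep_deriv c h (snd c x, s) (v, 0) \<bullet> w (chart_inv c (snd c x)) = 0"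
      by (rule inner_const_derivative[where F = "\<lambda>u. w (chart_inv c u)" and G = "\<lambda>u. w (chart_inv c u)" and k = "r\<^sup>2",
            OF open_chart_image[OF c(1)] chart_in_image[OF c(2)] dw[OF c(1) chart_in_image[OF c(2)]]
            dw[OF c(1) chart_in_image[OF c(2)]]])
        (rule ww[OF in_topspace[OF c(1) chart_inv_in]])
    then show ?thesis using c by (simp add: inner_commute)
  qed
  define \<sigma> where "\<sigma> x = w x \<bullet> N_s (x, s) / \<rho> (x, s)" for x
  have decomp: "w x = (w x \<bullet> N (x, s)) *\<^sub>R N (x, s) + (\<sigma> x * inverse (\<rho> (x, s))) *\<^sub>R N_s (x, s)"
    if "x \<in> fst c" "c \<in> A" for x c
    using perp_leaf_decomposition_h[OF that(2,1) s perp[OF that(2,1)]]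
    by (simp add: \<sigma>_def power2_eq_square divide_inverse mult.assoc)
  have a: "w x \<bullet> N (x, s) = w x0 \<bullet> N (x0, s)" if "x \<in> topspace X" for x
  proof (rule zero_derivative_imp_constant[where h = "\<lambda>x. w x \<bullet> N (x, s)", OF _ that x0])
    fix c u assume c: "c \<in> A" and u: "u \<in> chart_image c"
    let ?x = "chart_inv c u"
    have x: "?x \<in> fst c" "snd c ?x = u" using u by simp_all
    \<comment> \<open>Both summands vanish: \<open>w\<close> is a combination of N and
      \<open>N_s\<close>, which are orthogonal to the leaf image under N, and N is normal to
      \<open>h\<close>.\<close>
    have "w ?x \<bullet> rep_deriv c N (u, s) (v, 0) + rep_deriv c h (u, s) (v, 0) \<bullet> N (?x, s) = 0" for v
    proof -
      have "w ?x \<bullet> rep_deriv c N (u, s) (v, 0)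
          = ((w ?x \<bullet> N (?x, s)) *\<^sub>R N (?x, s) + (\<sigma> ?x * inverse (\<rho> (?x, s))) *\<^sub>R N_s (?x, s)) \<bullet> rep_deriv c N (u, s) (v, 0)"
        using decomp[OF x(1) c] by simp
      also have "\<dots> = 0"
        using N_perp_rep_deriv[OF c x(1) s, of "(v, 0)"] N_s_perp_rep_deriv[OF c x(1) s, of v]
        by (simp add: x(2) inner_add_left)
      finally show ?thesis
        using h_perp_N[OF c x(1) s, of "(v, 0)"] by (simp add: x(2) inner_commute)
    qed
    then show "((\<lambda>u. w (chart_inv c u) \<bullet> N (chart_inv c u, s)) has_derivative (\<lambda>v. 0)) (at u)"
      using has_derivative_inner[OF dw[OF c u] rep_has_derivative_fst[OF smooth_N c u s]]
      by (simp add: local_rep_def)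
  qed
  have sq: "(\<sigma> x)\<^sup>2 = r\<^sup>2 - (w x0 \<bullet> N (x0, s))\<^sup>2" if x: "x \<in> topspace X" for x
  proof -
    obtain c where "c \<in> A" "x \<in> fst c" using chart_at[OF x] by blast
    then have "w x \<bullet> w x = w x \<bullet> ((w x \<bullet> N (x, s)) *\<^sub>R N (x, s) + (\<sigma> x * inverse (\<rho> (x, s))) *\<^sub>R N_s (x, s))"
      using decomp by simp
    also have "\<dots> = (w x \<bullet> N (x, s))\<^sup>2 + (\<sigma> x)\<^sup>2"
      by (simp only: inner_add_right inner_scaleR_right) (simp add: \<sigma>_def power2_eq_square divide_inverse)
    finally show ?thesis using ww[OF x] a[OF x] by simp
  qed
  have b: "\<sigma> x = \<sigma> x0" if "x \<in> topspace X" for x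
    unfolding \<sigma>_def
  proof (rule leaf_component_constant[OF s _ sq[unfolded \<sigma>_def] that x0])
    show "continuous_on (chart_image c) (\<lambda>u. w (chart_inv c u))" if "c \<in> A" for c
      using has_derivative_continuous[OF dw[OF that]] continuous_at_imp_continuous_on by blast
  qed
  have "h (x, s) = z + (w x0 \<bullet> N (x0, s)) *\<^sub>R N (x, s) + (\<sigma> x0 * inverse (\<rho> (x, s))) *\<^sub>R N_s (x, s)"
    if x: "x \<in> topspace X" for x
  proof -
    obtain c where "c \<in> A" "x \<in> fst c" using chart_at[OF x] by blast
    then have "w x = (w x0 \<bullet> N (x0, s)) *\<^sub>R N (x, s) + (\<sigma> x0 * inverse (\<rho> (x, s))) *\<^sub>R N_s (x, s)"
      using decomp[of x c] unfolding a[OF x] b[OF x] by blast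
    then show ?thesis by (simp add: w_def algebra_simps)
  qed
  then show ?thesis by blast
qed

end

section \<open>Comparing two hypersurfaces with the same Gauss map\<close>

lemma smooth_on_has_vector_derivative_deriv:
  fixes F :: "real \<Rightarrow> real"
  assumes "smooth_on S F" "s \<in> S"
  shows "(F has_vector_derivative deriv F s) (at s)"
  using smooth_on_has_vector_derivative[OF assms] DERIV_imp_deriv
  by (metis has_real_derivative_iff_has_vector_derivative)

context interval_product
begin

lemma smooth_fun_curve:
  assumes "smooth_fun A I F" "x \<in> topspace X"
  shows "smooth_on I (\<lambda>s. F (x, s))"
proof -
  obtain c where c: "c \<in> A" "x \<in> fst c" using chart_at[OF assms(2)] by blast
  have "smooth_on I (\<lambda>s. local_rep c F (snd c x, s))"
    by (rule smooth_on_slice[OF smooth_fun_rep[OF assms(1) c(1)] chart_in_image[OF c(2)] open_I])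
  then show ?thesis using c by simp
qed

lemma smooth_fun_curve_push:
  assumes "smooth_fun A I F" "x \<in> topspace X"
  shows "smooth_on I (\<lambda>s. push A F (x, s) d_s)"
  by (rule smooth_on_cong[OF open_I, THEN iffD1, OF _ smooth_on_vector_derivative[OF open_I smooth_fun_curve[OF assms]]])
    (rule vector_derivative_at[OF push_has_vector_derivative[OF assms]])

end

text \<open>N maps no leaf into a hyperplane, so for each s the vectors \<open>(N (x, s), 1)\<close>
  span the ambient space times the reals. The point \<open>x0\<close> turns \<open>v = 0\<close>
  into \<open>k = 0\<close> and supplies a scalar equation for the coefficient
  \<open>b\<close>.\<close>

locale spanning_enneper = enneper_hypersurface X A I N \<rho> h
  for X :: "'m topology" and A :: "('m, 'e::euclidean_space) chart set" and I :: "real set"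
    and N :: "'m \<times> real \<Rightarrow> 'v::euclidean_space" and \<rho> :: "'m \<times> real \<Rightarrow> real"
    and h :: "'m \<times> real \<Rightarrow> 'v" +
  fixes x0 :: 'm
  assumes smooth_rho: "smooth_fun A I \<rho>" and x0: "x0 \<in> topspace X"
    and spanning: "\<And>s v k. s \<in> I \<Longrightarrow> (\<And>x. x \<in> topspace X \<Longrightarrow> v \<bullet> N (x, s) + k = 0) \<Longrightarrow> v = 0"
begin

lemma leaf_not_planar:
  assumes "s \<in> I" "\<And>x. x \<in> topspace X \<Longrightarrow> v \<bullet> N (x, s) + k = 0"
  shows "v = 0" "k = 0"
  using spanning[OF assms] assms(2)[OF x0] by simp_all

text \<open>The centre \<open>c\<close> and the coefficient \<open>a\<close> are the only solution of the linear equations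
  \<open>c \<bullet> N + a = h \<bullet> N\<close> at the points of a leaf, hence smooth in \<open>s\<close>. Differentiating these
  equations in \<open>s\<close> yields the compatibility condition.\<close>

lemma smooth_leaf_form:
  obtains c a b where "smooth_on I c" "smooth_on I a" "smooth_on I b"
    "\<And>x s. x \<in> topspace X \<Longrightarrow> s \<in> I \<Longrightarrow>
       h (x, s) = c s + a s *\<^sub>R N (x, s) + (b s * inverse (\<rho> (x, s))) *\<^sub>R N_s (x, s)"
    "\<And>x s. x \<in> topspace X \<Longrightarrow> s \<in> I \<Longrightarrow>
       vector_derivative c (at s) \<bullet> N (x, s) + deriv a s = b s * \<rho> (x, s)"
proof -
  have "\<forall>s\<in>I. \<exists>c a b. \<forall>x\<in>topspace X.
      h (x, s) = c + a *\<^sub>R N (x, s) + (b * inverse (\<rho> (x, s))) *\<^sub>R N_s (x, s)"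
    using leaf_form by blast
  then obtain c a b where form: "\<And>x s. x \<in> topspace X \<Longrightarrow> s \<in> I \<Longrightarrow>
       h (x, s) = c s + a s *\<^sub>R N (x, s) + (b s * inverse (\<rho> (x, s))) *\<^sub>R N_s (x, s)"
    by metis
  have hN: "h (x, s) \<bullet> N (x, s) = c s \<bullet> N (x, s) + a s" if "x \<in> topspace X" "s \<in> I" for x s
    using N_perp_N_s[OF that]
    by (simp add: form[OF that] inner_add_left N_inner_N[OF that] inner_commute[of "N_s (x, s)"])
  have hNs: "h (x, s) \<bullet> N_s (x, s) = c s \<bullet> N_s (x, s) + b s * \<rho> (x, s)" if "x \<in> topspace X" "s \<in> I" for x s
    using N_perp_N_s[OF that] rho_pos[OF that]
    by (simp add: form[OF that] inner_add_left N_s_norm[OF that] power2_eq_square)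
  have smooth_curve_N: "smooth_on I (\<lambda>s. N (x, s))" if "x \<in> topspace X" for x
    by (rule smooth_fun_curve[OF smooth_N that])
  \<comment> \<open>One equation for each point x of the leaf, with unknown
    \<open>(c s, a s)\<close> and coefficient vector \<open>(N (x, s), 1)\<close>.\<close>
  have "smooth_on I (\<lambda>s. (c s, a s))"
  proof (rule smooth_on_linear_solution[where K = "topspace X" and w = "\<lambda>x s. (N (x, s), 1)", OF open_I])
    fix x assume x: "x \<in> topspace X"
    have "bounded_linear (\<lambda>y::'v. (y, 0::real))"
      by (intro bounded_linear_Pair bounded_linear_ident bounded_linear_zero)
    from smooth_on_add[OF open_I smooth_on_linear[OF this open_I smooth_curve_N[OF x]] smooth_on_const[of I "(0, 1)"]]
    show "smooth_on I (\<lambda>s. (N (x, s), 1::real))" by simp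
    have "smooth_on I (\<lambda>s. h (x, s) \<bullet> N (x, s))"
      by (rule smooth_on_inner[OF open_I smooth_fun_curve[OF smooth_h x] smooth_curve_N[OF x]])
    then show "smooth_on I (\<lambda>s. (N (x, s), 1) \<bullet> (c s, a s))"
      by (rule smooth_on_cong[OF open_I, THEN iffD1, rotated]) (simp add: hN[OF x], simp add: inner_commute)
  next
    fix s and z :: "'v \<times> real"
    assume s: "s \<in> I" and "\<And>x. x \<in> topspace X \<Longrightarrow> (N (x, s), 1) \<bullet> z = 0"
    then have "fst z \<bullet> N (x, s) + snd z = 0" if "x \<in> topspace X" for x
      using that by (cases z) (simp add: inner_commute)
    from leaf_not_planar[OF s this] show "z = 0" by (simp add: prod_eq_iff)
  qed
  from smooth_on_linear[OF bounded_linear_fst open_I this] smooth_on_linear[OF bounded_linear_snd open_I this]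
  have c: "smooth_on I c" and a: "smooth_on I a" by simp_all
  \<comment> \<open>\<open>b\<close> solves the scalar equation
    \<open>\<rho> b = (h - c) \<bullet> N_s\<close> at \<open>x0\<close>, whose coefficient is
    positive.\<close>
  have b: "smooth_on I b"
  proof (rule smooth_on_linear_solution[where K = "{()}" and w = "\<lambda>_ s. \<rho> (x0, s)", OF open_I])
    show "smooth_on I (\<lambda>s. \<rho> (x0, s))"
      by (rule smooth_fun_curve[OF smooth_rho x0])
    have "smooth_on I (\<lambda>s. (h (x0, s) - c s) \<bullet> N_s (x0, s))"
      by (intro smooth_on_inner smooth_on_diff open_I smooth_fun_curve[OF smooth_h x0] c
          smooth_fun_curve_push[OF smooth_N x0])
    then show "smooth_on I (\<lambda>s. \<rho> (x0, s) \<bullet> b s)"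
      by (rule smooth_on_cong[OF open_I, THEN iffD1, rotated]) (simp add: inner_diff_left hNs[OF x0])
  next
    fix s v assume "s \<in> I" "\<And>i. i \<in> {()} \<Longrightarrow> \<rho> (x0, s) \<bullet> v = 0"
    then show "v = 0" using rho_pos[OF x0, of s] by simp
  qed
  have "vector_derivative c (at s) \<bullet> N (x, s) + deriv a s = b s * \<rho> (x, s)"
    if x: "x \<in> topspace X" and s: "s \<in> I" for x s
  proof -
    have dN: "((\<lambda>s. N (x, s)) has_vector_derivative N_s (x, s)) (at s)"
      by (rule push_has_vector_derivative[OF smooth_N x s])
    \<comment> \<open>Two derivatives of \<open>h \<bullet> N\<close>: from its expression by
      \<open>c\<close> and \<open>a\<close>, and by the Leibniz rule, where
      \<open>h_s \<bullet> N\<close> vanishes. Comparing them and inserting \<open>hNs\<close> gives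
      the condition.\<close>
    have "((\<lambda>s. c s \<bullet> N (x, s) + a s) has_vector_derivative
        (c s \<bullet> N_s (x, s) + vector_derivative c (at s) \<bullet> N (x, s)) + deriv a s) (at s)"
      by (intro has_vector_derivative_add smooth_on_has_vector_derivative_deriv[OF a s]
          bounded_bilinear.has_vector_derivative[OF bounded_bilinear_inner smooth_on_has_vector_derivative[OF c s] dN])
    moreover have "((\<lambda>s. c s \<bullet> N (x, s) + a s) has_vector_derivative
        h (x, s) \<bullet> N_s (x, s) + push A h (x, s) d_s \<bullet> N (x, s)) (at s)"
      by (rule has_vector_derivative_transform_within_open[OF
          bounded_bilinear.has_vector_derivative[OF bounded_bilinear_inner
            push_has_vector_derivative[OF smooth_h x s] dN] open_I s]) (rule hN[OF x])
    moreover obtain k where "push A h (x, s) d_s = k *\<^sub>R N_s (x, s)"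
      using h_s_parallel_N_s[OF x s] by blast
    ultimately show ?thesis
      using vector_derivative_unique_at hNs[OF x s] N_perp_N_s[OF x s] by (fastforce simp: inner_commute)
  qed
  then show ?thesis using that c a b form by blast
qed

end

section \<open>Comparison of the two parametrizations\<close>

theorem proposition27:
  fixes n :: nat
    and X :: "'m topology"
    and A :: "('m, 'e::euclidean_space) chart set"
    and I :: "real set"
    and f N :: "'m \<times> real \<Rightarrow> 'v::euclidean_space"
    and \<rho> :: "'m \<times> real \<Rightarrow> real"
    and g :: "real \<Rightarrow> 'm \<Rightarrow> ('m, 'e) tvec \<Rightarrow> ('m, 'e) tvec \<Rightarrow> real"
    and \<gamma> :: "real \<Rightarrow> 'v"
    and \<alpha> \<beta> :: "real \<Rightarrow> real"
    and fbar :: "'m \<times> real \<Rightarrow> 'v"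
  assumes dim_M0: "DIM('e) = n - 1"
    and dim_ambient: "DIM('v) = n + 1"
    and M0: "smooth_manifold X A" "connected_space X"
    and I: "open I" "is_interval I" "I \<noteq> {}"
    and f: "enneper_type A I f"
    and N: "gauss_map A I f N" "local_diffeo_sphere X A I N"
    and rho: "smooth_fun A I \<rho>" "\<forall>p\<in>prod_manifold A I. 0 < \<rho> p"
    and g: "smooth_metric_family A I g"
    and metric_N: "\<forall>x s. (x, s) \<in> prod_manifold A I \<longrightarrow>
           (\<forall>V\<in>prod_tangent A (x, s). \<forall>W\<in>prod_tangent A (x, s).
              induced_metric A N (x, s) V W
                = g s x (fst V) (fst W) + (\<rho> (x, s))\<^sup>2 * snd V * snd W)"
    and gamma: "smooth_on I \<gamma>" "\<forall>s\<in>I. vector_derivative \<gamma> (at s) \<noteq> 0"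
    and alpha_beta: "smooth_on I \<alpha>" "smooth_on I \<beta>"
    and param_f: "\<forall>x s. (x, s) \<in> prod_manifold A I \<longrightarrow>
           f (x, s) = \<gamma> s + \<alpha> s *\<^sub>R N (x, s) + (\<beta> s * inverse (\<rho> (x, s))) *\<^sub>R push A N (x, s) d_s"
    and compat: "\<forall>x s. (x, s) \<in> prod_manifold A I \<longrightarrow>
           vector_derivative \<gamma> (at s) \<bullet> N (x, s) + deriv \<alpha> s = \<beta> s * \<rho> (x, s)"
    and no_round_leaf: "\<not> (\<exists>s\<in>I. \<exists>S. round_sphere_codim2 S \<and> openin (top_of_set S) (f ` leaf A s))"
    and fbar: "enneper_type A I fbar" "gauss_map A I fbar N"
  shows "\<exists>\<gamma>bar \<alpha>bar \<beta>bar lam.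
           smooth_on I (\<gamma>bar :: real \<Rightarrow> 'v) \<and> smooth_on I (\<alpha>bar :: real \<Rightarrow> real) \<and>
           smooth_on I (\<beta>bar :: real \<Rightarrow> real) \<and> smooth_on I (lam :: real \<Rightarrow> real) \<and>
           (\<forall>x s. (x, s) \<in> prod_manifold A I \<longrightarrow>
              fbar (x, s) = \<gamma>bar s + \<alpha>bar s *\<^sub>R N (x, s)
                            + (\<beta>bar s * inverse (\<rho> (x, s))) *\<^sub>R push A N (x, s) d_s) \<and>
           (\<forall>s\<in>I. \<beta>bar s = lam s * \<beta> s \<and>
                   deriv \<alpha>bar s = lam s * deriv \<alpha> s \<and>
                   vector_derivative \<gamma>bar (at s) = lam s *\<^sub>R vector_derivative \<gamma> (at s))"
proof -
  have dim: "DIM('v) = DIM('e) + 2"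
    using dim_M0 dim_ambient DIM_positive[where 'a = 'e] by simp
  interpret interval_product X A I
    using M0(1) I(1) by unfold_locales
  \<comment> \<open>\<open>d_s\<close> has zero component along the factor \<open>M_0\<close>, so
    this removes its g-terms from the metric of N.\<close>
  have g_zero: "g s x V (\<lambda>_. 0) = 0" if "x \<in> topspace X" "s \<in> I" "V \<in> tangent_space A x" for s x V
  proof -
    have "g s x (\<lambda>c. 0 *\<^sub>R V c + 0 *\<^sub>R V c) V = 0 * g s x V V + 0 * g s x V V"
      using g that unfolding smooth_metric_family_def topspace_eq by blast
    moreover have "g s x V (\<lambda>_. 0) = g s x (\<lambda>_. 0) V"
      using g that zero_tangent[OF that(1)] unfolding smooth_metric_family_def topspace_eq by blast
    ultimately show ?thesis by simp
  qed
  have metric: "push A N (x, s) (V, t) \<bullet> push A N (x, s) (W, t') = g s x V W + (\<rho> (x, s))\<^sup>2 * t * t'"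
    if "x \<in> topspace X" "s \<in> I" "V \<in> tangent_space A x" "W \<in> tangent_space A x" for x s V W t t'
  proof -
    have "(V, t) \<in> prod_tangent A (x, s)" "(W, t') \<in> prod_tangent A (x, s)"
      using that by (simp_all add: prod_tangent_def)
    then have "induced_metric A N (x, s) (V, t) (W, t')
        = g s x (fst (V, t)) (fst (W, t')) + (\<rho> (x, s))\<^sup>2 * snd (V, t) * snd (W, t')"
      using metric_N that(1,2) unfolding prod_manifold_iff by blast
    then show ?thesis by (simp add: induced_metric_def)
  qed
  interpret gauss_frame X A I N \<rho>
  proof
    show "DIM('v) = DIM('e) + 2" by (rule dim)
    show "connected_space X" by (rule M0(2))
    show "smooth_fun A I N" using N(1) by (simp add: gauss_map_def)
  next
    fix x s assume xs: "x \<in> topspace X" "s \<in> I"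
    then have p: "(x, s) \<in> prod_manifold A I" by (simp add: prod_manifold_iff)
    show "norm (N (x, s)) = 1" using N(1) p by (auto simp: gauss_map_def)
    show "0 < \<rho> (x, s)" using rho(2) p by blast
    show "push A N (x, s) d_s \<bullet> push A N (x, s) d_s = (\<rho> (x, s))\<^sup>2"
      using metric[OF xs zero_tangent[OF xs(1)] zero_tangent[OF xs(1)]] g_zero[OF xs zero_tangent[OF xs(1)]]
      by (simp add: d_s_def)
    fix V assume V: "V \<in> tangent_space A x"
    show "push A N (x, s) (V, 0) \<bullet> push A N (x, s) d_s = 0"
      using metric[OF xs V zero_tangent[OF xs(1)]] g_zero[OF xs V] by (simp add: d_s_def)
    assume "push A N (x, s) (V, 0) = 0"
    then have "g s x V V = 0" using metric[OF xs V V, of 0 0] by simp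
    moreover have "0 < g s x V V" if "V \<noteq> (\<lambda>_. 0)"
      using g xs V that unfolding smooth_metric_family_def topspace_eq by blast
    ultimately show "V = (\<lambda>_. 0)" by (metis less_irrefl)
  qed
  interpret f: enneper_hypersurface X A I N \<rho> f
    using f N(1) by unfold_locales
  interpret fbar: enneper_hypersurface X A I N \<rho> fbar
    using fbar by unfold_locales
  obtain s1 where s1: "s1 \<in> I" using I(3) by blast
  \<comment> \<open>For empty \<open>M_0\<close> a leaf would have empty image, which is an open
    subset of every round sphere, against \<open>no_round_leaf\<close>.\<close>
  have "topspace X \<noteq> {}"
  proof
    assume "topspace X = {}"
    then have "f ` leaf A s1 = {}" by (simp add: leaf_def topspace_eq)
    moreover obtain b :: 'v where b: "b \<in> Basis" using nonempty_Basis by blast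
    have "round_sphere_codim2 {y \<in> sphere 0 1. (y - 0) \<bullet> b = 0}"
      unfolding round_sphere_codim2_def using b by (intro exI[of _ 0] exI[of _ 1] exI[of _ b]) auto
    ultimately show False using no_round_leaf s1 by (metis openin_empty)
  qed
  then obtain x0 where x0: "x0 \<in> topspace X" by blast
  \<comment> \<open>The absence of round leaves is a hypothesis on \<open>f\<close>, but the
    conclusion concerns N alone and so carries over to \<open>fbar\<close>.\<close>
  have spanning: "v = 0" if s: "s \<in> I" and plane: "\<And>x. x \<in> topspace X \<Longrightarrow> v \<bullet> N (x, s) + k = 0" for s v k
  proof (rule ccontr)
    assume v: "v \<noteq> 0"
    have "v \<bullet> N (x, s) = - k" if "x \<in> topspace X" for x
      using plane[OF that] by simp
    with param_f s have "\<exists>S. round_sphere_codim2 S \<and> openin (top_of_set S) (f ` leaf A s)"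
      by (intro f.planar_leaf_imp_round[OF N(2) x0 s _ v]) (simp_all add: prod_manifold_iff)
    then show False using no_round_leaf s by blast
  qed
  interpret fbar: spanning_enneper X A I N \<rho> fbar x0
  proof unfold_locales
    show "v = 0" if "s \<in> I" "\<And>x. x \<in> topspace X \<Longrightarrow> v \<bullet> N (x, s) + k = 0" for s v k
      using that by (rule spanning)
  qed (rule rho(1), rule x0)
  obtain c a b where smooth: "smooth_on I c" "smooth_on I a" "smooth_on I b"
    and form: "\<And>x s. x \<in> topspace X \<Longrightarrow> s \<in> I \<Longrightarrow>
       fbar (x, s) = c s + a s *\<^sub>R N (x, s) + (b s * inverse (\<rho> (x, s))) *\<^sub>R N_s (x, s)"
    and compat_bar: "\<And>x s. x \<in> topspace X \<Longrightarrow> s \<in> I \<Longrightarrow>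
       vector_derivative c (at s) \<bullet> N (x, s) + deriv a s = b s * \<rho> (x, s)"
    by (rule fbar.smooth_leaf_form) blast
  have compat': "vector_derivative \<gamma> (at s) \<bullet> N (x, s) + deriv \<alpha> s = \<beta> s * \<rho> (x, s)"
    if "x \<in> topspace X" "s \<in> I" for x s
    using compat that by (simp add: prod_manifold_iff)
  \<comment> \<open>At a zero of \<beta> the compatibility condition would be a hyperplane equation
    for N with normal \<gamma>', so \<gamma>' would vanish, contrary to regularity.\<close>
  have \<beta>: "\<beta> s \<noteq> 0" if s: "s \<in> I" for s
  proof
    assume "\<beta> s = 0"
    then have "vector_derivative \<gamma> (at s) = 0"
      using compat' s by (intro spanning[OF s, of _ "deriv \<alpha> s"]) simp
    then show False using gamma(2) s by blast
  qed
  define lam where "lam s = b s / \<beta> s" for s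
  have lam: "b s = lam s * \<beta> s" if "s \<in> I" for s
    using \<beta>[OF that] by (simp add: lam_def)
  have "smooth_on I lam"
  \<comment> \<open>The quotient is smooth as the solution of \<open>\<beta> lam = b\<close> with
    nowhere vanishing coefficient.\<close>
  proof (rule smooth_on_linear_solution[where K = "{()}" and w = "\<lambda>_. \<beta>", OF I(1) alpha_beta(2)])
    show "smooth_on I (\<lambda>s. \<beta> s \<bullet> lam s)"
      by (rule smooth_on_cong[OF I(1), THEN iffD1, OF _ smooth(3)]) (simp add: lam)
  qed (use \<beta> in simp)
  moreover have "vector_derivative c (at s) = lam s *\<^sub>R vector_derivative \<gamma> (at s)"
    and "deriv a s = lam s * deriv \<alpha> s" if s: "s \<in> I" for s
  proof -
    \<comment> \<open>Subtracting \<open>lam\<close> times the condition for \<open>f\<close> from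
      the one for \<open>fbar\<close> cancels \<rho> and leaves a hyperplane equation for N, whose
      coefficients must vanish.\<close>
    have "(vector_derivative c (at s) - lam s *\<^sub>R vector_derivative \<gamma> (at s)) \<bullet> N (x, s)
        + (deriv a s - lam s * deriv \<alpha> s) = 0" if x: "x \<in> topspace X" for x
    proof -
      have "vector_derivative c (at s) \<bullet> N (x, s) + deriv a s
          = lam s * (vector_derivative \<gamma> (at s) \<bullet> N (x, s) + deriv \<alpha> s)"
        unfolding compat_bar[OF x s] compat'[OF x s] lam[OF s] by simp
      then show ?thesis by (simp add: inner_diff_left algebra_simps)
    qed
    from fbar.leaf_not_planar[OF s this]
    show "vector_derivative c (at s) = lam s *\<^sub>R vector_derivative \<gamma> (at s)"
      and "deriv a s = lam s * deriv \<alpha> s" by simp_all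
  qed
  ultimately show ?thesis
    using smooth form lam
    by (intro exI[of _ c] exI[of _ a] exI[of _ b] exI[of _ lam]) (simp add: prod_manifold_iff)
qed

end
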